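(* The category $\mathbf{GI\text{-}TopSys}$ is equivalent to the category $\mathbf{FESA}$.
   Context: An ordered topological space $(X,\leq,\tau)$ (with $\le$ a partial order) is an Esakia space if $(X,\tau)$ is compact; for any $x,y\in X$ with $x\nleq y$ there exists a clopen up-set $U\subseteq X$ with $x\in U$, $y\notin U$; and for any clopen set $U$ the down-set $\downarrow U$ is also clopen. An Esakia morphism between Esakia spaces is a continuous bounded morphism (p-morphism) $f:X\to Y$, i.e. a continuous order-preserving map such that for each $x\in X$, $y\in Y$, if $f(x)\le y$ then there exists $z\in X$ with $x\le z$ and $f(z)=y$. $\mathbf{FESA}$ is the category of Esakia spaces whose order structure is a forest (for every $x$ the principal up-set $\{y : x\le y\}$ is a chain), with Esakia morphisms. A Heyting algebra is an algebra $(A,\vee,\wedge,\rightarrow,\mathbf{1},\mathbf{0})$ such that $(A,\vee,\wedge,\mathbf{1},\mathbf{0})$ is a bounded distributive lattice and $\rightarrow$ is a binary operation adjoint to $\wedge$ ($c\wedge a\le b$ iff $c\le a\rightarrow b$). A Gödel algebra is a Heyting algebra satisfying prelinearity: $(a\rightarrow b)\vee(b\rightarrow a)=\mathbf{1}$ for all $a,b\in A$. A Heyting homomorphism is a map preserving $\wedge,\vee,\rightarrow,\mathbf{0}$. $Hom(A,\{0,1\})$ denotes the set of all bounded distributive lattice homomorphisms from $A$ to the two-element algebra $\{0,1\}$, ordered pointwise: $h_1Rh_2$ iff $h_1(a)\le h_2(a)$ for all $a\in A$. A Gödel algebraic I-topological system is a triple $(X,\models,A)$ consisting of a nonempty set $X$,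 a Gödel algebra $A$ and a binary relation $\models$ from $X$ to $A$ such that: (1) $x\models\mathbf{0}$ for no $x\in X$; (2) $x\models a\wedge b$ iff $x\models a$ and $x\models b$; (3) $x\models a\vee b$ iff $x\models a$ or $x\models b$; (4) $x\models a\rightarrow b$ iff for all $y\in X$ such that $p^*(x)Rp^*(y)$, $y\not\models a$ or $y\models b$, where $p^*:X\to Hom(A,\{0,1\})$ is given by $p^*(x)(a)=1$ iff $x\models a$; (5) the map $p^*$ is a bijection. $\mathbf{GI\text{-}TopSys}$ is the category whose objects are Gödel algebraic I-topological systems and whose morphisms $(X,\models,A)\to(Y,\models',B)$ are pairs $(f_1,f_2)$ with $f_1:X\to Y$ a map of sets, $f_2:B\to A$ a Heyting homomorphism, and $x\models f_2(b)$ iff $f_1(x)\models' b$ for all $x\in X$, $b\in B$. Identities are $(id_X,id_A)$ and composition is $(g_1,g_2)\circ(f_1,f_2)=(g_1\circ f_1,f_2\circ g_2)$.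
   Formalization: Esakia spaces are taken nonempty: with the empty space FESA has an initial object while GI-TopSys, whose point sets are nonempty, has none. Points and algebra elements range over arbitrary fixed universes, the first infinite and embeddable in the second. *)

theory Defs
  imports "HOL-Analysis.Abstract_Topology" "HOL-Library.Equipollence"
begin

text \<open>
  Categories are given by hom-sets: an arrow is only an arrow relative to a domain and a
  codomain, so identities and composition are indexed by objects, and \<open>Comp C X Y Z g f\<close> is the
  composite of \<open>f : X \<rightarrow> Y\<close> followed by \<open>g : Y \<rightarrow> Z\<close>.
\<close>

record ('o, 'm) cat =
  Obj :: "'o set"
  Hom :: "'o \<Rightarrow> 'o \<Rightarrow> 'm set"
  Id :: "'o \<Rightarrow> 'm"
  Comp :: "'o \<Rightarrow> 'o \<Rightarrow> 'o \<Rightarrow> 'm \<Rightarrow> 'm \<Rightarrow> 'm"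

definition category :: "('o, 'm) cat \<Rightarrow> bool" where
  "category C \<longleftrightarrow>
     (\<forall>X \<in> Obj C. Id C X \<in> Hom C X X) \<and>
     (\<forall>X \<in> Obj C. \<forall>Y \<in> Obj C. \<forall>Z \<in> Obj C. \<forall>f \<in> Hom C X Y. \<forall>g \<in> Hom C Y Z.
        Comp C X Y Z g f \<in> Hom C X Z) \<and>
     (\<forall>X \<in> Obj C. \<forall>Y \<in> Obj C. \<forall>f \<in> Hom C X Y.
        Comp C X X Y f (Id C X) = f \<and> Comp C X Y Y (Id C Y) f = f) \<and>
     (\<forall>W \<in> Obj C. \<forall>X \<in> Obj C. \<forall>Y \<in> Obj C. \<forall>Z \<in> Obj C.
        \<forall>f \<in> Hom C W X. \<forall>g \<in> Hom C X Y. \<forall>h \<in> Hom C Y Z.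
        Comp C W X Z (Comp C X Y Z h g) f = Comp C W Y Z h (Comp C W X Y g f))"

record ('o, 'm, 'p, 'n) ftor =
  obj_map :: "'o \<Rightarrow> 'p"
  arr_map :: "'o \<Rightarrow> 'o \<Rightarrow> 'm \<Rightarrow> 'n"

definition is_functor :: "('o, 'm) cat \<Rightarrow> ('p, 'n) cat \<Rightarrow> ('o, 'm, 'p, 'n) ftor \<Rightarrow> bool" where
  "is_functor C D F \<longleftrightarrow>
     (\<forall>X \<in> Obj C. obj_map F X \<in> Obj D) \<and>
     (\<forall>X \<in> Obj C. \<forall>Y \<in> Obj C. \<forall>f \<in> Hom C X Y.
        arr_map F X Y f \<in> Hom D (obj_map F X) (obj_map F Y)) \<and>
     (\<forall>X \<in> Obj C. arr_map F X X (Id C X) = Id D (obj_map F X)) \<and>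
     (\<forall>X \<in> Obj C. \<forall>Y \<in> Obj C. \<forall>Z \<in> Obj C. \<forall>f \<in> Hom C X Y. \<forall>g \<in> Hom C Y Z.
        arr_map F X Z (Comp C X Y Z g f) =
        Comp D (obj_map F X) (obj_map F Y) (obj_map F Z) (arr_map F Y Z g) (arr_map F X Y f))"

definition id_ftor :: "('o, 'm, 'o, 'm) ftor" where
  "id_ftor = \<lparr>obj_map = (\<lambda>X. X), arr_map = (\<lambda>X Y f. f)\<rparr>"

definition comp_ftor ::
    "('p, 'n, 'q, 'k) ftor \<Rightarrow> ('o, 'm, 'p, 'n) ftor \<Rightarrow> ('o, 'm, 'q, 'k) ftor" where
  "comp_ftor G F =
     \<lparr>obj_map = (\<lambda>X. obj_map G (obj_map F X)),
      arr_map = (\<lambda>X Y f. arr_map G (obj_map F X) (obj_map F Y) (arr_map F X Y f))\<rparr>"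

definition is_iso :: "('o, 'm) cat \<Rightarrow> 'o \<Rightarrow> 'o \<Rightarrow> 'm \<Rightarrow> bool" where
  "is_iso C X Y f \<longleftrightarrow> f \<in> Hom C X Y \<and>
     (\<exists>g \<in> Hom C Y X. Comp C X Y X g f = Id C X \<and> Comp C Y X Y f g = Id C Y)"

definition natural_iso ::
    "('o, 'm) cat \<Rightarrow> ('p, 'n) cat \<Rightarrow> ('o, 'm, 'p, 'n) ftor \<Rightarrow> ('o, 'm, 'p, 'n) ftor \<Rightarrow>
     ('o \<Rightarrow> 'n) \<Rightarrow> bool" where
  "natural_iso C D F G \<eta> \<longleftrightarrow>
     (\<forall>X \<in> Obj C. is_iso D (obj_map F X) (obj_map G X) (\<eta> X)) \<and>
     (\<forall>X \<in> Obj C. \<forall>Y \<in> Obj C. \<forall>f \<in> Hom C X Y.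
        Comp D (obj_map F X) (obj_map F Y) (obj_map G Y) (\<eta> Y) (arr_map F X Y f) =
        Comp D (obj_map F X) (obj_map G X) (obj_map G Y) (arr_map G X Y f) (\<eta> X))"

definition equivalent_categories :: "('o, 'm) cat \<Rightarrow> ('p, 'n) cat \<Rightarrow> bool" where
  "equivalent_categories C D \<longleftrightarrow> category C \<and> category D \<and>
     (\<exists>F G \<eta> \<epsilon>. is_functor C D F \<and> is_functor D C G \<and>
        natural_iso C C id_ftor (comp_ftor G F) \<eta> \<and>
        natural_iso D D (comp_ftor F G) id_ftor \<epsilon>)"

record 'x ordered_space =
  topology_of :: "'x topology"
  ord :: "'x rel"

abbreviation pts :: "'x ordered_space \<Rightarrow> 'x set" where
  "pts E \<equiv> topspace (topology_of E)"

definition clopenin :: "'x topology \<Rightarrow> 'x set \<Rightarrow> bool" where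
  "clopenin T U \<longleftrightarrow> openin T U \<and> closedin T U"

definition up_set :: "'x ordered_space \<Rightarrow> 'x set \<Rightarrow> bool" where
  "up_set E U \<longleftrightarrow> U \<subseteq> pts E \<and> (\<forall>x \<in> U. \<forall>y \<in> pts E. (x, y) \<in> ord E \<longrightarrow> y \<in> U)"

definition down_closure :: "'x ordered_space \<Rightarrow> 'x set \<Rightarrow> 'x set" where
  "down_closure E U = {x \<in> pts E. \<exists>y \<in> U. (x, y) \<in> ord E}"

definition esakia_space :: "'x ordered_space \<Rightarrow> bool" where
  "esakia_space E \<longleftrightarrow>
     partial_order_on (pts E) (ord E) \<and>
     compact_space (topology_of E) \<and>
     (\<forall>x \<in> pts E. \<forall>y \<in> pts E. (x, y) \<notin> ord E \<longrightarrow>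
        (\<exists>U. clopenin (topology_of E) U \<and> up_set E U \<and> x \<in> U \<and> y \<notin> U)) \<and>
     (\<forall>U. clopenin (topology_of E) U \<longrightarrow> clopenin (topology_of E) (down_closure E U))"

definition forest :: "'x ordered_space \<Rightarrow> bool" where
  "forest E \<longleftrightarrow> (\<forall>x \<in> pts E. total_on {y \<in> pts E. (x, y) \<in> ord E} (ord E))"

text \<open>
  Maps between carrier sets are represented by functions that are \<^const>\<open>undefined\<close> outside their
  domain (\<^const>\<open>extensional\<close>), so that equality of arrows is equality of maps on the carrier.
\<close>

definition esakia_hom :: "'x ordered_space \<Rightarrow> 'y ordered_space \<Rightarrow> ('x \<Rightarrow> 'y) set" where
  "esakia_hom E F = {f. f \<in> extensional (pts E) \<and>
     continuous_map (topology_of E) (topology_of F) f \<and>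
     (\<forall>x \<in> pts E. \<forall>y \<in> pts E. (x, y) \<in> ord E \<longrightarrow> (f x, f y) \<in> ord F) \<and>
     (\<forall>x \<in> pts E. \<forall>y \<in> pts F. (f x, y) \<in> ord F \<longrightarrow>
        (\<exists>z \<in> pts E. (x, z) \<in> ord E \<and> f z = y))}"

text \<open>
  Spaces are nonempty by convention. This is the convention under which FESA matches I-topological
  systems, whose point sets are required to be nonempty.
\<close>

definition FESA :: "('x ordered_space, 'x \<Rightarrow> 'x) cat" where
  "FESA = \<lparr>
     Obj = {E. esakia_space E \<and> forest E \<and> pts E \<noteq> {}},
     Hom = esakia_hom,
     Id = (\<lambda>E. restrict id (pts E)),
     Comp = (\<lambda>E F G g f. compose (pts E) g f)\<rparr>"

record 'a heyting =
  carrier :: "'a set"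
  join :: "'a \<Rightarrow> 'a \<Rightarrow> 'a"
  meet :: "'a \<Rightarrow> 'a \<Rightarrow> 'a"
  imp :: "'a \<Rightarrow> 'a \<Rightarrow> 'a"
  one :: 'a
  zero :: 'a

definition bounded_distributive_lattice :: "'a heyting \<Rightarrow> bool" where
  "bounded_distributive_lattice A \<longleftrightarrow>
     one A \<in> carrier A \<and> zero A \<in> carrier A \<and>
     (\<forall>a \<in> carrier A. \<forall>b \<in> carrier A. join A a b \<in> carrier A \<and> meet A a b \<in> carrier A) \<and>
     (\<forall>a \<in> carrier A. \<forall>b \<in> carrier A. join A a b = join A b a \<and> meet A a b = meet A b a) \<and>
     (\<forall>a \<in> carrier A. \<forall>b \<in> carrier A. \<forall>c \<in> carrier A.
        join A (join A a b) c = join A a (join A b c) \<and>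
        meet A (meet A a b) c = meet A a (meet A b c)) \<and>
     (\<forall>a \<in> carrier A. \<forall>b \<in> carrier A.
        join A a (meet A a b) = a \<and> meet A a (join A a b) = a) \<and>
     (\<forall>a \<in> carrier A. \<forall>b \<in> carrier A. \<forall>c \<in> carrier A.
        meet A a (join A b c) = join A (meet A a b) (meet A a c)) \<and>
     (\<forall>a \<in> carrier A. meet A a (one A) = a \<and> join A a (zero A) = a)"

definition le :: "'a heyting \<Rightarrow> 'a \<Rightarrow> 'a \<Rightarrow> bool" where
  "le A a b \<longleftrightarrow> meet A a b = a"

definition heyting_algebra :: "'a heyting \<Rightarrow> bool" where
  "heyting_algebra A \<longleftrightarrow> bounded_distributive_lattice A \<and>
     (\<forall>a \<in> carrier A. \<forall>b \<in> carrier A. imp A a b \<in> carrier A) \<and>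
     (\<forall>a \<in> carrier A. \<forall>b \<in> carrier A. \<forall>c \<in> carrier A.
        le A (meet A c a) b \<longleftrightarrow> le A c (imp A a b))"

definition goedel_algebra :: "'a heyting \<Rightarrow> bool" where
  "goedel_algebra A \<longleftrightarrow> heyting_algebra A \<and>
     (\<forall>a \<in> carrier A. \<forall>b \<in> carrier A. join A (imp A a b) (imp A b a) = one A)"

definition heyting_hom :: "'a heyting \<Rightarrow> 'b heyting \<Rightarrow> ('a \<Rightarrow> 'b) set" where
  "heyting_hom A B = {h. h \<in> carrier A \<rightarrow>\<^sub>E carrier B \<and>
     (\<forall>a \<in> carrier A. \<forall>b \<in> carrier A.
        h (meet A a b) = meet B (h a) (h b) \<and>
        h (join A a b) = join B (h a) (h b) \<and>
        h (imp A a b) = imp B (h a) (h b)) \<and>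
     h (zero A) = zero B}"

text \<open>The two-element algebra \<open>{0, 1}\<close> is \<^typ>\<open>bool\<close>, with \<open>0\<close> and \<open>1\<close> being \<open>False\<close> and \<open>True\<close>.\<close>

definition Hom2 :: "'a heyting \<Rightarrow> ('a \<Rightarrow> bool) set" where
  "Hom2 A = {h. h \<in> extensional (carrier A) \<and>
     (\<forall>a \<in> carrier A. \<forall>b \<in> carrier A.
        (h (meet A a b) \<longleftrightarrow> h a \<and> h b) \<and> (h (join A a b) \<longleftrightarrow> h a \<or> h b)) \<and>
     h (one A) = True \<and> h (zero A) = False}"

definition R :: "'a heyting \<Rightarrow> ('a \<Rightarrow> bool) \<Rightarrow> ('a \<Rightarrow> bool) \<Rightarrow> bool" where
  "R A h1 h2 \<longleftrightarrow> (\<forall>a \<in> carrier A. h1 a \<le> h2 a)"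

record ('x, 'a) system =
  points :: "'x set"
  sat :: "'x \<Rightarrow> 'a \<Rightarrow> bool"
  alg :: "'a heyting"

definition pstar :: "('x, 'a) system \<Rightarrow> 'x \<Rightarrow> 'a \<Rightarrow> bool" where
  "pstar S x = restrict (sat S x) (carrier (alg S))"

definition GI_system :: "('x, 'a) system \<Rightarrow> bool" where
  "GI_system S \<longleftrightarrow> (let X = points S; A = alg S in
     X \<noteq> {} \<and> goedel_algebra A \<and>
     (\<forall>x \<in> X. \<not> sat S x (zero A)) \<and>
     (\<forall>x \<in> X. \<forall>a \<in> carrier A. \<forall>b \<in> carrier A.
        sat S x (meet A a b) \<longleftrightarrow> sat S x a \<and> sat S x b) \<and>
     (\<forall>x \<in> X. \<forall>a \<in> carrier A. \<forall>b \<in> carrier A.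
        sat S x (join A a b) \<longleftrightarrow> sat S x a \<or> sat S x b) \<and>
     (\<forall>x \<in> X. \<forall>a \<in> carrier A. \<forall>b \<in> carrier A.
        sat S x (imp A a b) \<longleftrightarrow>
        (\<forall>y \<in> X. R A (pstar S x) (pstar S y) \<longrightarrow> \<not> sat S y a \<or> sat S y b)) \<and>
     bij_betw (pstar S) X (Hom2 A))"

definition GI_hom ::
    "('x, 'a) system \<Rightarrow> ('y, 'b) system \<Rightarrow> (('x \<Rightarrow> 'y) \<times> ('b \<Rightarrow> 'a)) set" where
  "GI_hom S T = {(f1, f2).
     f1 \<in> points S \<rightarrow>\<^sub>E points T \<and>
     f2 \<in> heyting_hom (alg T) (alg S) \<and>
     (\<forall>x \<in> points S. \<forall>b \<in> carrier (alg T). sat S x (f2 b) \<longleftrightarrow> sat T (f1 x) b)}"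

text \<open>
  The types \<open>'x\<close> of points and \<open>'a\<close> of algebra elements act as universes. For every space over
  \<open>'x\<close> to have a copy of its algebra of clopen up-sets over \<open>'a\<close>, it suffices that \<open>'x\<close> is infinite and
  embeds into \<open>'a\<close>: an infinite Esakia space has at most as many clopens as points.
\<close>

definition GI_TopSys :: "(('x, 'a) system, ('x \<Rightarrow> 'x) \<times> ('a \<Rightarrow> 'a)) cat" where
  "GI_TopSys = \<lparr>
     Obj = {S. GI_system S},
     Hom = GI_hom,
     Id = (\<lambda>S. (restrict id (points S), restrict id (carrier (alg S)))),
     Comp = (\<lambda>S T U g f.
       (compose (points S) (fst g) (fst f), compose (carrier (alg U)) (snd f) (snd g)))\<rparr>"

end

theory Submission
  imports Defs "HOL-Analysis.Function_Topology"
begin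

text \<open>
  Forgetting the algebra of a system \<open>(X, \<Turnstile>, A)\<close> leaves the set \<open>X\<close>, topologized by declaring the
  extents \<open>{x. x \<Turnstile> a}\<close> clopen and ordered by inclusion of satisfied elements. Since \<open>p\<^sup>*\<close> identifies \<open>X\<close>
  with the prime spectrum of \<open>A\<close>, this space is compact (Tychonoff), its clopen up-sets are exactly the
  extents, and extents determine elements (prime filter theorem). The second component of a morphism of
  systems is therefore the preimage map of the first, so the forgetful functor to FESA is fully faithful.
  It hits every object on the nose: an Esakia forest is recovered from the Goedel algebra of its clopen
  up-sets, and this algebra can be coded in \<open>'a\<close> because, by compactness, every clopen up-set is a finite
  union of finite intersections from a family of clopens indexed by pairs of points.
\<close>

subsection \<open>Equivalences from fully faithful functors surjective on objects\<close>

text \<open>The points of a system are a subset of \<open>'x\<close>, like those of a space, so a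
  space can serve as the point set of its own system and only the algebra has to be moved to another
  type. This is what allows surjectivity on objects to be an equality; the inverse functor is then
  merely chosen. Bijectivity of \<open>pstar\<close> supplies compactness and antisymmetry. The
  clause for implication supplies clopen down-sets, because the points refuting
  \<open>a \<rightarrow> b\<close> are exactly those below some point that satisfies
  \<open>a\<close> but not \<open>b\<close>. Prelinearity supplies the forest condition.
  Consequences of compactness are always drawn in one form: if a closed set is covered by open sets
  from a family that contains \<open>{}\<close> and is closed under binary unions, then a single
  member covers it. An algebraic contradiction can then be read off from that one member, without
  handling finite subcovers.\<close>

lemma equivalent_categories_if_fully_faithful_surj:
  assumes C: "category C" and D: "category D" and F: "is_functor C D F"
    and full: "\<And>X Y g. \<lbrakk>X \<in> Obj C; Y \<in> Obj C; g \<in> Hom D (obj_map F X) (obj_map F Y)\<rbrakk>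
      \<Longrightarrow> \<exists>f \<in> Hom C X Y. arr_map F X Y f = g"
    and faithful: "\<And>X Y. \<lbrakk>X \<in> Obj C; Y \<in> Obj C\<rbrakk> \<Longrightarrow> inj_on (arr_map F X Y) (Hom C X Y)"
    and surj: "\<And>E. E \<in> Obj D \<Longrightarrow> \<exists>X \<in> Obj C. obj_map F X = E"
  shows "equivalent_categories C D"
proof -
  \<comment> \<open>\<open>H\<close> is a strict section of the object map, and \<open>L\<close>
    inverts \<open>F\<close> on each hom-set. An equation in \<open>C\<close> is proved by applying
    \<open>F\<close> to both sides and using faithfulness (\<open>eqI\<close>), which turns it into
    an identity law or a functor law in \<open>D\<close>.\<close>
  obtain H where H: "\<And>E. E \<in> Obj D \<Longrightarrow> H E \<in> Obj C" "\<And>E. E \<in> Obj D \<Longrightarrow> obj_map F (H E) = E"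
    using surj by metis
  define L where "L X Y = inv_into (Hom C X Y) (arr_map F X Y)" for X Y
  have L: "L X Y g \<in> Hom C X Y" "arr_map F X Y (L X Y g) = g"
    if "X \<in> Obj C" "Y \<in> Obj C" "g \<in> Hom D (obj_map F X) (obj_map F Y)" for X Y g
    using full[OF that] unfolding L_def by (auto intro: inv_into_into f_inv_into_f)
  have eqI: "f = g" if "X \<in> Obj C" "Y \<in> Obj C" "f \<in> Hom C X Y" "g \<in> Hom C X Y"
    "arr_map F X Y f = arr_map F X Y g" for X Y f g
    using faithful[OF that(1,2)] that(3-5) by (auto dest: inj_onD)
  have F_obj: "obj_map F X \<in> Obj D" if "X \<in> Obj C" for X
    using F that unfolding is_functor_def by blast
  have F_arr: "arr_map F X Y f \<in> Hom D (obj_map F X) (obj_map F Y)"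
    if "X \<in> Obj C" "Y \<in> Obj C" "f \<in> Hom C X Y" for X Y f
    using F that unfolding is_functor_def by blast
  have F_id: "arr_map F X X (Id C X) = Id D (obj_map F X)" if "X \<in> Obj C" for X
    using F that unfolding is_functor_def by blast
  have F_comp: "arr_map F X Z (Comp C X Y Z g f) =
      Comp D (obj_map F X) (obj_map F Y) (obj_map F Z) (arr_map F Y Z g) (arr_map F X Y f)"
    if "X \<in> Obj C" "Y \<in> Obj C" "Z \<in> Obj C" "f \<in> Hom C X Y" "g \<in> Hom C Y Z" for X Y Z f g
    using F that unfolding is_functor_def by blast
  have C_id: "Id C X \<in> Hom C X X" if "X \<in> Obj C" for X
    using C that unfolding category_def by blast
  have C_comp: "Comp C X Y Z g f \<in> Hom C X Z"
    if "X \<in> Obj C" "Y \<in> Obj C" "Z \<in> Obj C" "f \<in> Hom C X Y" "g \<in> Hom C Y Z" for X Y Z f g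
    using C that unfolding category_def by blast
  have D_id: "Id D X \<in> Hom D X X" if "X \<in> Obj D" for X
    using D that unfolding category_def by blast
  have D_comp: "Comp D X Y Z g f \<in> Hom D X Z"
    if "X \<in> Obj D" "Y \<in> Obj D" "Z \<in> Obj D" "f \<in> Hom D X Y" "g \<in> Hom D Y Z" for X Y Z f g
    using D that unfolding category_def by blast
  have D_unit: "Comp D X X Y f (Id D X) = f" "Comp D X Y Y (Id D Y) f = f"
    if "X \<in> Obj D" "Y \<in> Obj D" "f \<in> Hom D X Y" for X Y f
    using D that unfolding category_def by blast+
  define G where "G = \<lparr>obj_map = H, arr_map = (\<lambda>E E'. L (H E) (H E'))\<rparr>"
  \<comment> \<open>Since \<open>H (F X)\<close> and \<open>X\<close> have the same image under
    \<open>F\<close>, the identity of that image lifts to arrows in both directions. On the other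
    side \<open>F (H E) = E\<close>, so the counit is the identity.\<close>
  define \<eta> where "\<eta> X = L X (H (obj_map F X)) (Id D (obj_map F X))" for X
  define \<eta>' where "\<eta>' X = L (H (obj_map F X)) X (Id D (obj_map F X))" for X
  have HF: "H (obj_map F X) \<in> Obj C" "obj_map F (H (obj_map F X)) = obj_map F X"
    if "X \<in> Obj C" for X
    using that F_obj H by auto
  have \<eta>: "\<eta> X \<in> Hom C X (H (obj_map F X))"
    "arr_map F X (H (obj_map F X)) (\<eta> X) = Id D (obj_map F X)"
    "\<eta>' X \<in> Hom C (H (obj_map F X)) X"
    "arr_map F (H (obj_map F X)) X (\<eta>' X) = Id D (obj_map F X)" if "X \<in> Obj C" for X
    unfolding \<eta>_def \<eta>'_def using that by (simp_all add: L HF D_id F_obj)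
  have G_functor: "is_functor D C G"
    unfolding is_functor_def G_def ftor.simps
  proof (intro conjI ballI)
    fix X assume X: "X \<in> Obj D"
    show "L (H X) (H X) (Id D X) = Id C (H X)"
      by (rule eqI[of "H X" "H X"]) (use X in \<open>simp_all add: H L D_id C_id F_id\<close>)
  next
    fix X Y Z f g
    assume "X \<in> Obj D" "Y \<in> Obj D" "Z \<in> Obj D" "f \<in> Hom D X Y" "g \<in> Hom D Y Z"
    then show "L (H X) (H Z) (Comp D X Y Z g f) =
        Comp C (H X) (H Y) (H Z) (L (H Y) (H Z) g) (L (H X) (H Y) f)"
      by (intro eqI[of "H X" "H Z"]) (simp_all add: H L D_comp C_comp F_comp)
  qed (auto simp: H L)
  have iso: "is_iso C X (H (obj_map F X)) (\<eta> X)" if X: "X \<in> Obj C" for X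
    unfolding is_iso_def
  proof (intro conjI bexI[of _ "\<eta>' X"])
    show "Comp C X (H (obj_map F X)) X (\<eta>' X) (\<eta> X) = Id C X"
      by (rule eqI[of X X]) (use X in \<open>simp_all add: HF \<eta> C_id C_comp F_id F_comp D_unit D_id F_obj\<close>)
    show "Comp C (H (obj_map F X)) X (H (obj_map F X)) (\<eta> X) (\<eta>' X) = Id C (H (obj_map F X))"
      by (rule eqI[of "H (obj_map F X)" "H (obj_map F X)"])
        (use X in \<open>simp_all add: HF \<eta> C_id C_comp F_id F_comp D_unit D_id F_obj\<close>)
  qed (use \<eta> X in auto)
  have unit: "natural_iso C C id_ftor (comp_ftor G F) \<eta>"
    unfolding natural_iso_def id_ftor_def comp_ftor_def G_def ftor.simps
  proof (intro conjI ballI)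
    fix X Y f assume X: "X \<in> Obj C" and Y: "Y \<in> Obj C" and f: "f \<in> Hom C X Y"
    have L': "L (H (obj_map F X)) (H (obj_map F Y)) (arr_map F X Y f)
        \<in> Hom C (H (obj_map F X)) (H (obj_map F Y))"
      "arr_map F (H (obj_map F X)) (H (obj_map F Y))
        (L (H (obj_map F X)) (H (obj_map F Y)) (arr_map F X Y f)) = arr_map F X Y f"
      using X Y f by (simp_all add: L HF F_arr)
    show "Comp C X Y (H (obj_map F Y)) (\<eta> Y) f =
        Comp C X (H (obj_map F X)) (H (obj_map F Y))
          (L (H (obj_map F X)) (H (obj_map F Y)) (arr_map F X Y f)) (\<eta> X)"
      by (rule eqI[of X "H (obj_map F Y)"])
        (use X Y f L' in \<open>simp_all add: HF \<eta> C_comp F_comp D_unit F_obj F_arr\<close>)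
  qed (use iso in auto)
  have counit: "natural_iso D D (comp_ftor F G) id_ftor (Id D)"
    unfolding natural_iso_def id_ftor_def comp_ftor_def G_def ftor.simps is_iso_def
    by (auto simp: H L D_id D_unit intro!: bexI[OF _ D_id])
  show ?thesis
    unfolding equivalent_categories_def using C D F G_functor unit counit by blast
qed

subsection \<open>Cardinality and compactness\<close>

text \<open>Finite subsets are sorted by size. A set of size \<open>n + 1\<close> arises by
  inserting a point into one of size \<open>n\<close>, so \<open>A \<times> A\<close> being
  equipotent to \<open>A\<close> bounds every level by \<open>A\<close>, and a countable union of
  levels stays below the infinite \<open>A\<close>.\<close>

lemma Fpow_lepoll:
  includes cardinal_syntax
  assumes "infinite A"
  shows "Fpow A \<lesssim> A"
proof -
  define S where "S n = {B. B \<subseteq> A \<and> finite B \<and> card B = n}" for n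
  have S: "|S n| \<le>o |A|" for n
  proof (induction n)
    case 0
    have "S 0 = {{}}" by (auto simp: S_def)
    moreover from assms obtain a where "a \<in> A" by fastforce
    ultimately show ?case by (auto intro!: card_of_ordLeqI[of "\<lambda>_. a"])
  next
    case (Suc n)
    have "S (Suc n) \<subseteq> (\<lambda>(a, B). insert a B) ` (A \<times> S n)"
    proof
      fix B assume B: "B \<in> S (Suc n)"
      then obtain a B' where "B = insert a B'" "a \<notin> B'" "card B' = n" "finite B'"
        by (auto simp: S_def card_Suc_eq_finite)
      with B show "B \<in> (\<lambda>(a, B). insert a B) ` (A \<times> S n)"
        by (auto simp: S_def image_iff)
    qed
    then have "|S (Suc n)| \<le>o |A \<times> S n|"
      by (metis card_of_image card_of_mono1 ordLeq_transitive)
    also have "|A \<times> S n| \<le>o |A \<times> A|"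
      using Suc by (rule card_of_Times_mono2)
    also have "|A \<times> A| =o |A|"
      using assms by (rule card_of_Times_same_infinite)
    finally show ?case .
  qed
  have "Fpow A = (\<Union>n. S n)" by (auto simp: Fpow_def S_def)
  moreover have "|\<Union>n. S n| \<le>o |A|"
    using S assms by (intro card_of_UNION_ordLeq_infinite) (auto simp: infinite_iff_card_of_nat)
  ultimately show ?thesis
    by (metis card_of_ordLeq lepoll_def)
qed

text \<open>Closure under binary unions collapses a finite subcover to one member; \<open>{}\<close>
  handles the empty subcover.\<close>

lemma closedin_subset_directed_cover:
  assumes T: "compact_space T" and K: "closedin T K"
    and empty: "{} \<in> B" and Un: "\<And>U V. \<lbrakk>U \<in> B; V \<in> B\<rbrakk> \<Longrightarrow> U \<union> V \<in> B"
    and op: "\<And>U. U \<in> B \<Longrightarrow> openin T U" and cover: "\<And>x. x \<in> K \<Longrightarrow> \<exists>U \<in> B. x \<in> U"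
  shows "\<exists>U \<in> B. K \<subseteq> U"
proof -
  have "compactin T K" using T K by (rule closedin_compact_space)
  then obtain \<F> where \<F>: "finite \<F>" "\<F> \<subseteq> B" "K \<subseteq> \<Union>\<F>"
    unfolding compactin_def using op cover by (metis UnionI subsetI)
  have "\<Union>\<F> \<in> B" using \<F>(1,2) by (induction rule: finite_induct) (auto simp: empty Un)
  with \<F> show ?thesis by blast
qed

lemma clopenin_closures [simp]:
  "clopenin T {}" "clopenin T (topspace T)"
  "\<lbrakk>clopenin T U; clopenin T V\<rbrakk> \<Longrightarrow> clopenin T (U \<union> V)"
  "\<lbrakk>clopenin T U; clopenin T V\<rbrakk> \<Longrightarrow> clopenin T (U \<inter> V)"
  "\<lbrakk>clopenin T U; clopenin T V\<rbrakk> \<Longrightarrow> clopenin T (U - V)"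
  unfolding clopenin_def by (auto intro: openin_diff closedin_diff)

lemma clopenin_subset: "clopenin T U \<Longrightarrow> U \<subseteq> topspace T"
  by (simp add: clopenin_def openin_subset)

text \<open>The complements of the members of \<open>B\<close> around \<open>x\<close> form a
  directed open cover of the closed complement of \<open>C\<close>. One of them covers it, and its
  complement is the desired neighbourhood.\<close>

lemma separated_nhd_in_open:
  assumes T: "compact_space T" and C: "openin T C"
    and top: "topspace T \<in> B" and Int: "\<And>U V. \<lbrakk>U \<in> B; V \<in> B\<rbrakk> \<Longrightarrow> U \<inter> V \<in> B"
    and cl: "\<And>U. U \<in> B \<Longrightarrow> closedin T U" and x: "x \<in> C"
    and sep: "\<And>y. y \<in> topspace T - C \<Longrightarrow> \<exists>U \<in> B. x \<in> U \<and> y \<notin> U"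
  shows "\<exists>U \<in> B. x \<in> U \<and> U \<subseteq> C"
proof -
  have "\<exists>V \<in> {topspace T - U |U. U \<in> B \<and> x \<in> U}. topspace T - C \<subseteq> V"
  proof (rule closedin_subset_directed_cover[OF T])
    show "{} \<in> {topspace T - U |U. U \<in> B \<and> x \<in> U}"
      using top x C by (auto dest: openin_subset)
    show "U \<union> V \<in> {topspace T - U |U. U \<in> B \<and> x \<in> U}"
      if UV: "U \<in> {topspace T - U |U. U \<in> B \<and> x \<in> U}" "V \<in> {topspace T - U |U. U \<in> B \<and> x \<in> U}"
      for U V
    proof -
      from UV obtain U' V' where "U = topspace T - U'" "V = topspace T - V'" "U' \<in> B" "V' \<in> B"
        "x \<in> U'" "x \<in> V'" by blast
      then have "U \<union> V = topspace T - (U' \<inter> V')" "U' \<inter> V' \<in> B" "x \<in> U' \<inter> V'" using Int by auto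
      then show ?thesis by blast
    qed
    show "\<exists>V \<in> {topspace T - U |U. U \<in> B \<and> x \<in> U}. y \<in> V" if "y \<in> topspace T - C" for y
      using sep[OF that] that by blast
    show "openin T V" if "V \<in> {topspace T - U |U. U \<in> B \<and> x \<in> U}" for V
      using that cl by (auto intro: openin_diff)
    show "closedin T (topspace T - C)" using C by blast
  qed
  then obtain U where U: "U \<in> B" "x \<in> U" "topspace T - C \<subseteq> topspace T - U" by blast
  moreover have "U \<subseteq> topspace T" using cl[OF U(1)] by (rule closedin_subset)
  ultimately show ?thesis by blast
qed

text \<open>Compactness enters twice: each point of \<open>C\<close> gets a neighbourhood from
  \<open>B\<close> inside \<open>C\<close>, and then one union of such neighbourhoods fills
  \<open>C\<close>. Separation is asked only from points of \<open>C\<close> to points outside, so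
  the lemma also applies to lattices of up-sets, which separate in one direction of the
  order.\<close>

lemma clopenin_mem_separating_lattice:
  assumes T: "compact_space T" and C: "clopenin T C"
    and empty: "{} \<in> B" and top: "topspace T \<in> B"
    and Un: "\<And>U V. \<lbrakk>U \<in> B; V \<in> B\<rbrakk> \<Longrightarrow> U \<union> V \<in> B"
    and Int: "\<And>U V. \<lbrakk>U \<in> B; V \<in> B\<rbrakk> \<Longrightarrow> U \<inter> V \<in> B"
    and cl: "\<And>U. U \<in> B \<Longrightarrow> clopenin T U"
    and sep: "\<And>x y. \<lbrakk>x \<in> C; y \<in> topspace T - C\<rbrakk> \<Longrightarrow> \<exists>U \<in> B. x \<in> U \<and> y \<notin> U"
  shows "C \<in> B"
proof -
  have "\<exists>U \<in> {U \<in> B. U \<subseteq> C}. C \<subseteq> U"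
  proof (rule closedin_subset_directed_cover[OF T])
    fix x assume x: "x \<in> C"
    have "\<exists>U \<in> B. x \<in> U \<and> U \<subseteq> C"
      by (rule separated_nhd_in_open[OF T _ top Int]) (use C cl sep x in \<open>auto simp: clopenin_def\<close>)
    then show "\<exists>U \<in> {U \<in> B. U \<subseteq> C}. x \<in> U" by blast
  qed (use C cl in \<open>auto simp: clopenin_def empty Un\<close>)
  then show ?thesis by (metis (mono_tags, lifting) mem_Collect_eq subset_antisym)
qed

subsection \<open>Prime filters of distributive lattices\<close>

locale bdl =
  fixes A :: "'a heyting"
  assumes A: "bounded_distributive_lattice A"
begin

lemma closed [simp]:
  "one A \<in> carrier A" "zero A \<in> carrier A"
  "\<lbrakk>a \<in> carrier A; b \<in> carrier A\<rbrakk> \<Longrightarrow> join A a b \<in> carrier A"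
  "\<lbrakk>a \<in> carrier A; b \<in> carrier A\<rbrakk> \<Longrightarrow> meet A a b \<in> carrier A"
  using A by (auto simp: bounded_distributive_lattice_def)

lemma
  assumes "a \<in> carrier A" "b \<in> carrier A"
  shows join_comm: "join A a b = join A b a" and meet_comm: "meet A a b = meet A b a"
    and join_absorb: "join A a (meet A a b) = a" and meet_absorb: "meet A a (join A a b) = a"
  using A assms by (auto simp: bounded_distributive_lattice_def)

lemma
  assumes "a \<in> carrier A" "b \<in> carrier A" "c \<in> carrier A"
  shows meet_assoc: "meet A (meet A a b) c = meet A a (meet A b c)"
    and meet_join_distrib: "meet A a (join A b c) = join A (meet A a b) (meet A a c)"
  using A assms by (auto simp: bounded_distributive_lattice_def)

lemma meet_one: "a \<in> carrier A \<Longrightarrow> meet A a (one A) = a"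
  and join_zero: "a \<in> carrier A \<Longrightarrow> join A a (zero A) = a"
  using A by (auto simp: bounded_distributive_lattice_def)

lemma meet_idem: "a \<in> carrier A \<Longrightarrow> meet A a a = a"
  by (metis join_absorb meet_absorb closed(4))

lemma le_refl: "a \<in> carrier A \<Longrightarrow> le A a a"
  by (simp add: le_def meet_idem)

lemma le_trans:
  assumes "a \<in> carrier A" "b \<in> carrier A" "c \<in> carrier A" "le A a b" "le A b c"
  shows "le A a c"
  using assms meet_assoc[of a b c] by (simp add: le_def)

lemma le_antisym:
  assumes "a \<in> carrier A" "b \<in> carrier A" "le A a b" "le A b a"
  shows "a = b"
  using assms meet_comm[of a b] by (simp add: le_def)

lemma le_one: "a \<in> carrier A \<Longrightarrow> le A a (one A)"
  by (simp add: le_def meet_one)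

lemma zero_le: "a \<in> carrier A \<Longrightarrow> le A (zero A) a"
  unfolding le_def by (metis closed(2) join_comm join_zero meet_absorb)

lemma
  assumes "a \<in> carrier A" "b \<in> carrier A"
  shows meet_le1: "le A (meet A a b) a" and meet_le2: "le A (meet A a b) b"
proof -
  show "le A (meet A a b) b" using assms meet_assoc[of a b b] by (simp add: le_def meet_idem)
  show "le A (meet A a b) a" using assms meet_assoc[of b a a] by (simp add: le_def meet_idem meet_comm)
qed

lemma le_meet:
  assumes "a \<in> carrier A" "b \<in> carrier A" "c \<in> carrier A" "le A c a" "le A c b"
  shows "le A c (meet A a b)"
  using assms meet_assoc[of c a b] by (simp add: le_def)

lemma join_le:
  assumes "a \<in> carrier A" "b \<in> carrier A" "c \<in> carrier A" "le A a c" "le A b c"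
  shows "le A (join A a b) c"
  using assms meet_join_distrib[of c a b] by (simp add: le_def meet_comm)

lemma
  assumes "a \<in> carrier A" "b \<in> carrier A"
  shows le_join1: "le A a (join A a b)" and le_join2: "le A b (join A a b)"
  using assms meet_absorb[of a b] meet_absorb[of b a] by (simp_all add: le_def join_comm)

lemma meet_mono:
  assumes "a \<in> carrier A" "b \<in> carrier A" "c \<in> carrier A" "le A a b"
  shows "le A (meet A a c) (meet A b c)"
  using assms by (meson closed(4) le_meet le_trans meet_le1 meet_le2)

text \<open>A filter that is maximal among those containing \<open>a\<close> and avoiding
  \<open>b\<close> is prime, and its characteristic function is the required homomorphism.\<close>

theorem prime_filter_separation:
  assumes a: "a \<in> carrier A" and b: "b \<in> carrier A" and nle: "\<not> le A a b"
  shows "\<exists>h \<in> Hom2 A. h a \<and> \<not> h b"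
proof -
  define \<F> where "\<F> = {F. F \<subseteq> carrier A \<and> a \<in> F \<and> b \<notin> F \<and> (\<forall>x \<in> F. \<forall>y \<in> F. meet A x y \<in> F) \<and>
    (\<forall>x \<in> F. \<forall>y \<in> carrier A. le A x y \<longrightarrow> y \<in> F)}"
  have "\<exists>M \<in> \<F>. \<forall>F \<in> \<F>. M \<subseteq> F \<longrightarrow> F = M"
  proof (rule subset_Zorn_nonempty)
    have "{x \<in> carrier A. le A a x} \<in> \<F>"
      using a b nle by (auto simp: \<F>_def le_refl intro: le_meet le_trans)
    then show "\<F> \<noteq> {}" by blast
  next
    fix \<C> assume ne: "\<C> \<noteq> {}" and ch: "subset.chain \<F> \<C>"
    have sub: "F \<in> \<F>" if "F \<in> \<C>" for F using ch that by (auto simp: subset.chain_def)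
    have "meet A x y \<in> \<Union>\<C>" if "F \<in> \<C>" "G \<in> \<C>" "x \<in> F" "y \<in> G" for x y F G
    proof -
      have "F \<subseteq> G \<or> G \<subseteq> F" using ch that by (auto simp: subset_chain_def)
      then show ?thesis using that sub unfolding \<F>_def by blast
    qed
    then show "\<Union>\<C> \<in> \<F>" using ne sub unfolding \<F>_def by blast
  qed
  then obtain F where F: "F \<in> \<F>" and max: "\<And>G. \<lbrakk>G \<in> \<F>; F \<subseteq> G\<rbrakk> \<Longrightarrow> G = F" by blast
  have Fc: "x \<in> carrier A" if "x \<in> F" for x using F that by (auto simp: \<F>_def)
  have aF: "a \<in> F" and bF: "b \<notin> F" using F by (auto simp: \<F>_def)
  have Fm: "meet A x y \<in> F" if "x \<in> F" "y \<in> F" for x y using F that by (auto simp: \<F>_def)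
  have Fu: "y \<in> F" if "x \<in> F" "y \<in> carrier A" "le A x y" for x y using F that by (auto simp: \<F>_def)
  have ext: "\<exists>f \<in> F. le A (meet A f x) b" if x: "x \<in> carrier A" "x \<notin> F" for x
  proof (rule ccontr)
    assume neg: "\<not> ?thesis"
    \<comment> \<open>\<open>G\<close> is the filter generated by \<open>F\<close> and
      \<open>x\<close>. If it avoided \<open>b\<close>, maximality would force \<open>x\<close> into
      \<open>F\<close>.\<close>
    define G where "G = {z \<in> carrier A. \<exists>f \<in> F. le A (meet A f x) z}"
    have FG: "F \<subseteq> G" unfolding G_def using Fc x by (auto intro: meet_le1)
    have xG: "x \<in> G" unfolding G_def using Fc x aF by (auto intro: meet_le2)
    have "meet A y z \<in> G" if yz: "y \<in> G" "z \<in> G" for y z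
    proof -
      obtain f g where fg: "f \<in> F" "g \<in> F" "le A (meet A f x) y" "le A (meet A g x) z"
        and y: "y \<in> carrier A" and z: "z \<in> carrier A" using yz by (auto simp: G_def)
      note c = Fc[OF fg(1)] Fc[OF fg(2)] x(1) y z
      have "le A (meet A (meet A f g) x) (meet A f x)"
        using c by (intro meet_mono meet_le1) auto
      then have "le A (meet A (meet A f g) x) y" using c fg by (meson closed(4) le_trans)
      moreover have "le A (meet A (meet A f g) x) (meet A g x)"
        using c by (intro meet_mono meet_le2) auto
      then have "le A (meet A (meet A f g) x) z" using c fg by (meson closed(4) le_trans)
      ultimately have "le A (meet A (meet A f g) x) (meet A y z)" using c by (intro le_meet) auto
      then show ?thesis using c fg Fm by (auto simp: G_def)
    qed
    moreover have "z \<in> G" if "y \<in> G" "z \<in> carrier A" "le A y z" for y z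
      using that x(1) Fc unfolding G_def by (auto intro!: bexI intro: le_trans)
    ultimately have "G \<in> \<F>" using neg FG aF unfolding \<F>_def by (auto simp: G_def)
    then show False using max FG xG x by blast
  qed
  have prime: "x \<in> F \<or> y \<in> F" if x: "x \<in> carrier A" and y: "y \<in> carrier A" and j: "join A x y \<in> F" for x y
  proof (rule ccontr)
    assume "\<not> ?thesis"
    then obtain f g where fg: "f \<in> F" "g \<in> F" "le A (meet A f x) b" "le A (meet A g y) b"
      using ext x y by metis
    \<comment> \<open>The common lower bound \<open>k\<close> lies in \<open>F\<close> and satisfies
      both inequalities, so distributivity puts the meet of \<open>k\<close> and
      \<open>join A x y\<close> below \<open>b\<close>, and \<open>b\<close> would belong to
      \<open>F\<close>.\<close>
    define k where "k = meet A f g"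
    have k: "k \<in> F" "k \<in> carrier A" "le A k f" "le A k g"
      using fg Fm Fc by (auto simp: k_def intro: meet_le1 meet_le2)
    have "le A (meet A k x) (meet A f x)" "le A (meet A k y) (meet A g y)"
      using k fg Fc x y by (auto intro: meet_mono)
    then have "le A (meet A k x) b" "le A (meet A k y) b"
      using k fg Fc x y b by (meson closed(4) le_trans)+
    then have "le A (meet A k (join A x y)) b"
      using k x y b by (simp add: meet_join_distrib join_le)
    then show False using Fu[OF Fm[OF k(1) j] b] bF by blast
  qed
  have "restrict (\<lambda>x. x \<in> F) (carrier A) \<in> Hom2 A"
    unfolding Hom2_def
  proof (clarsimp, intro conjI ballI)
    fix x y assume c: "x \<in> carrier A" "y \<in> carrier A"
    show "(meet A x y \<in> F) = (x \<in> F \<and> y \<in> F)"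
      using c Fm Fu meet_le1[OF c] meet_le2[OF c] by blast
    show "(join A x y \<in> F) = (x \<in> F \<or> y \<in> F)"
      using c Fu le_join1[OF c] le_join2[OF c] prime closed(3)[OF c] by blast
  next
    show "one A \<in> F" using Fu[OF aF _ le_one[OF a]] by simp
    show "zero A \<notin> F" using Fu[OF _ b zero_le[OF b]] bF by blast
  qed
  then show ?thesis using a b aF bF by (intro bexI) auto
qed

end

subsection \<open>The Esakia space of a system\<close>

text \<open>This is the patch topology of the prime spectrum. One pair \<open>a\<close>,
  \<open>b\<close> per point is enough, because differences of two extents are closed under finite
  intersections and hence form a base.\<close>

definition extent_topology :: "('x, 'a) system \<Rightarrow> 'x topology" where
  "extent_topology S = topology (\<lambda>U. U \<subseteq> points S \<and>
     (\<forall>x \<in> U. \<exists>a \<in> carrier (alg S). \<exists>b \<in> carrier (alg S). sat S x a \<and> \<not> sat S x b \<and>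
        (\<forall>y \<in> points S. sat S y a \<and> \<not> sat S y b \<longrightarrow> y \<in> U)))"

text \<open>The relation \<open>R\<close> pulled back along \<open>pstar\<close> and restricted to
  the points.\<close>

definition extent_order :: "('x, 'a) system \<Rightarrow> 'x rel" where
  "extent_order S = {(x, y). x \<in> points S \<and> y \<in> points S \<and>
     (\<forall>a \<in> carrier (alg S). sat S x a \<longrightarrow> sat S y a)}"

definition space_of :: "('x, 'a) system \<Rightarrow> 'x ordered_space" where
  "space_of S = \<lparr>topology_of = extent_topology S, ord = extent_order S\<rparr>"

lemma space_of_simps [simp]:
  "topology_of (space_of S) = extent_topology S" "ord (space_of S) = extent_order S"
  by (simp_all add: space_of_def)

locale gi_system =
  fixes S :: "('x, 'a) system"
  assumes GI: "GI_system S"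
begin

abbreviation "X \<equiv> points S"
abbreviation "L \<equiv> carrier (alg S)"

section \<open>Satisfaction, points and extents\<close>

lemma goedel: "goedel_algebra (alg S)" and points_ne: "X \<noteq> {}"
  using GI by (auto simp: GI_system_def Let_def)

lemma heyting: "heyting_algebra (alg S)"
  using goedel by (simp add: goedel_algebra_def)

sublocale bdl "alg S"
  using heyting by unfold_locales (simp add: heyting_algebra_def)

lemma imp_closed [simp]: "\<lbrakk>a \<in> L; b \<in> L\<rbrakk> \<Longrightarrow> imp (alg S) a b \<in> L"
  using heyting by (simp add: heyting_algebra_def)

lemma sat_zero [simp]: "x \<in> X \<Longrightarrow> \<not> sat S x (zero (alg S))"
  and sat_meet [simp]: "\<lbrakk>x \<in> X; a \<in> L; b \<in> L\<rbrakk> \<Longrightarrow> sat S x (meet (alg S) a b) \<longleftrightarrow> sat S x a \<and> sat S x b"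
  and sat_join [simp]: "\<lbrakk>x \<in> X; a \<in> L; b \<in> L\<rbrakk> \<Longrightarrow> sat S x (join (alg S) a b) \<longleftrightarrow> sat S x a \<or> sat S x b"
  using GI by (auto simp: GI_system_def Let_def)

lemma R_pstar: "R (alg S) (pstar S x) (pstar S y) \<longleftrightarrow> (\<forall>a \<in> L. sat S x a \<longrightarrow> sat S y a)"
  by (auto simp: R_def pstar_def)

lemma sat_imp: "\<lbrakk>x \<in> X; a \<in> L; b \<in> L\<rbrakk> \<Longrightarrow> sat S x (imp (alg S) a b) \<longleftrightarrow>
    (\<forall>y. (x, y) \<in> extent_order S \<longrightarrow> sat S y a \<longrightarrow> sat S y b)"
  using GI by (auto simp: GI_system_def Let_def R_pstar extent_order_def)

lemma pstar_bij: "bij_betw (pstar S) X (Hom2 (alg S))"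
  using GI by (auto simp: GI_system_def Let_def)

lemma pstar_Hom2: "x \<in> X \<Longrightarrow> pstar S x \<in> Hom2 (alg S)"
  using pstar_bij by (auto simp: bij_betw_def)

lemma sat_one [simp]: "x \<in> X \<Longrightarrow> sat S x (one (alg S))"
  using pstar_Hom2[of x] by (auto simp: Hom2_def pstar_def)

lemma point_eqI:
  assumes "x \<in> X" "y \<in> X" "\<And>a. a \<in> L \<Longrightarrow> sat S x a \<longleftrightarrow> sat S y a"
  shows "x = y"
proof -
  have "pstar S x = pstar S y" using assms by (auto simp: pstar_def restrict_def fun_eq_iff)
  then show ?thesis using pstar_bij assms by (auto simp: bij_betw_def dest: inj_onD)
qed

text \<open>Surjectivity of \<open>pstar\<close> turns a prime filter that contains \<open>a\<close>
  but not \<open>b\<close> into a point of the system.\<close>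

lemma extent_subset_imp_le:
  assumes "a \<in> L" "b \<in> L" "\<And>x. x \<in> X \<Longrightarrow> sat S x a \<Longrightarrow> sat S x b"
  shows "le (alg S) a b"
proof (rule ccontr)
  assume "\<not> ?thesis"
  then obtain h where "h \<in> Hom2 (alg S)" "h a" "\<not> h b"
    using prime_filter_separation assms by blast
  moreover from this obtain x where "x \<in> X" "pstar S x = h"
    using pstar_bij by (metis bij_betw_def imageE)
  ultimately show False using assms by (auto simp: pstar_def)
qed

lemma extent_inject:
  assumes "a \<in> L" "b \<in> L" "\<And>x. x \<in> X \<Longrightarrow> sat S x a \<longleftrightarrow> sat S x b"
  shows "a = b"
proof (rule le_antisym)
  show "le (alg S) a b" using assms by (intro extent_subset_imp_le) auto
  show "le (alg S) b a" using assms by (intro extent_subset_imp_le) auto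
qed (use assms in auto)

section \<open>The extent topology and its compactness\<close>

lemma openin_extent_topology:
  "openin (extent_topology S) U \<longleftrightarrow> U \<subseteq> X \<and>
     (\<forall>x \<in> U. \<exists>a \<in> L. \<exists>b \<in> L. sat S x a \<and> \<not> sat S x b \<and>
        (\<forall>y \<in> X. sat S y a \<and> \<not> sat S y b \<longrightarrow> y \<in> U))"
proof -
  let ?P = "\<lambda>U x a b. sat S x a \<and> \<not> sat S x b \<and> (\<forall>y \<in> X. sat S y a \<and> \<not> sat S y b \<longrightarrow> y \<in> U)"
  have "istopology (\<lambda>U. U \<subseteq> X \<and> (\<forall>x \<in> U. \<exists>a \<in> L. \<exists>b \<in> L. ?P U x a b))"
    unfolding istopology_def
  proof (intro conjI allI impI)
    fix U V assume U: "U \<subseteq> X \<and> (\<forall>x \<in> U. \<exists>a \<in> L. \<exists>b \<in> L. ?P U x a b)"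
      and V: "V \<subseteq> X \<and> (\<forall>x \<in> V. \<exists>a \<in> L. \<exists>b \<in> L. ?P V x a b)"
    show "\<forall>x \<in> U \<inter> V. \<exists>a \<in> L. \<exists>b \<in> L. ?P (U \<inter> V) x a b"
    proof
      fix x assume x: "x \<in> U \<inter> V"
      then obtain a b a' b' where ab: "a \<in> L" "b \<in> L" "a' \<in> L" "b' \<in> L"
        and P: "?P U x a b" "?P V x a' b'" using U V by blast
      have "x \<in> X" using x U by blast
      then have "?P (U \<inter> V) x (meet (alg S) a a') (join (alg S) b b')" using ab P by auto
      then show "\<exists>a \<in> L. \<exists>b \<in> L. ?P (U \<inter> V) x a b" using ab by (meson closed(3,4))
    qed
  next
    fix \<U> assume U: "\<forall>U \<in> \<U>. U \<subseteq> X \<and> (\<forall>x \<in> U. \<exists>a \<in> L. \<exists>b \<in> L. ?P U x a b)"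
    then show "\<Union>\<U> \<subseteq> X" by blast
    show "\<forall>x \<in> \<Union>\<U>. \<exists>a \<in> L. \<exists>b \<in> L. ?P (\<Union>\<U>) x a b"
    proof
      fix x assume "x \<in> \<Union>\<U>"
      then obtain U where "U \<in> \<U>" "x \<in> U" by blast
      moreover then obtain a b where "a \<in> L" "b \<in> L" "?P U x a b" using U by blast
      ultimately show "\<exists>a \<in> L. \<exists>b \<in> L. ?P (\<Union>\<U>) x a b" by blast
    qed
  qed blast
  then show ?thesis by (simp add: extent_topology_def topology_inverse')
qed

lemma openin_basic: "\<lbrakk>a \<in> L; b \<in> L\<rbrakk> \<Longrightarrow> openin (extent_topology S) {x \<in> X. sat S x a \<and> \<not> sat S x b}"
  unfolding openin_extent_topology by blast

lemma topspace_extent [simp]: "topspace (extent_topology S) = X"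
proof
  show "topspace (extent_topology S) \<subseteq> X"
    using openin_extent_topology openin_topspace by blast
  have "openin (extent_topology S) X"
    unfolding openin_extent_topology using sat_one sat_zero closed(1,2) by blast
  then show "X \<subseteq> topspace (extent_topology S)" by (rule openin_subset)
qed

lemma clopenin_extent: 
  assumes "a \<in> L"
  shows "clopenin (extent_topology S) {x \<in> X. sat S x a}"
proof -
  have "X - {x \<in> X. sat S x a} = {x \<in> X. sat S x (one (alg S)) \<and> \<not> sat S x a}"
    "{x \<in> X. sat S x a} = {x \<in> X. sat S x a \<and> \<not> sat S x (zero (alg S))}" by auto
  then show ?thesis unfolding clopenin_def closedin_def
    using openin_basic assms by (auto simp del: sat_one sat_zero)
qed

text \<open>\<open>Hom2\<close> is a closed subset of a power of the discrete two-point space, and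
  the inverse \<open>q\<close> of \<open>pstar\<close> is a continuous map from it onto the
  points.\<close>

lemma compact_space_extent: "compact_space (extent_topology S)"
proof -
  define P where "P = product_topology (\<lambda>_::'a. discrete_topology (UNIV :: bool set)) L"
  have P: "compact_space P" by (simp add: P_def compact_space_product_topology compact_space_discrete_topology)
  have top: "topspace P = extensional L" by (auto simp: P_def PiE_UNIV_domain PiE_def)
  have ev: "clopenin P {h \<in> topspace P. h a}" if "a \<in> L" for a
  proof -
    have c: "continuous_map P (discrete_topology UNIV) (\<lambda>h. h a)"
      using that unfolding P_def by (rule continuous_map_product_projection)
    show ?thesis unfolding clopenin_def
      using openin_continuous_map_preimage[OF c, of "{True}"]
        closedin_continuous_map_preimage[OF c, of "{True}"] by auto
  qed
  have Not: "clopenin P {h \<in> topspace P. \<not> Q h}" if "clopenin P {h \<in> topspace P. Q h}" for Q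
  proof -
    have "{h \<in> topspace P. \<not> Q h} = topspace P - {h \<in> topspace P. Q h}" by blast
    then show ?thesis using that by simp
  qed
  have And: "clopenin P {h \<in> topspace P. Q h \<and> Q' h}"
    if "clopenin P {h \<in> topspace P. Q h}" "clopenin P {h \<in> topspace P. Q' h}" for Q Q'
  proof -
    have "{h \<in> topspace P. Q h \<and> Q' h} = {h \<in> topspace P. Q h} \<inter> {h \<in> topspace P. Q' h}" by blast
    then show ?thesis using that by simp
  qed
  have Or: "clopenin P {h \<in> topspace P. Q h \<or> Q' h}"
    if "clopenin P {h \<in> topspace P. Q h}" "clopenin P {h \<in> topspace P. Q' h}" for Q Q'
    using Not[OF And[OF Not[OF that(1)] Not[OF that(2)]]] by simp
  have Iff: "clopenin P {h \<in> topspace P. Q h \<longleftrightarrow> Q' h}"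
    if "clopenin P {h \<in> topspace P. Q h}" "clopenin P {h \<in> topspace P. Q' h}" for Q Q'
  proof -
    have "{h \<in> topspace P. Q h \<longleftrightarrow> Q' h} = {h \<in> topspace P. Q h \<and> Q' h \<or> \<not> Q h \<and> \<not> Q' h}" by blast
    then show ?thesis using Or[OF And[OF that] And[OF Not[OF that(1)] Not[OF that(2)]]] by simp
  qed
  \<comment> \<open>Each condition defining a homomorphism involves finitely many coordinates and so
    cuts out a clopen set. The rules above build these sets by Boolean combination of
    evaluations.\<close>
  define \<K> where "\<K> = {{h \<in> topspace P. h (one (alg S))}, {h \<in> topspace P. \<not> h (zero (alg S))}} \<union>
    (\<lambda>(a, b). {h \<in> topspace P. (h (meet (alg S) a b) \<longleftrightarrow> h a \<and> h b) \<and>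
      (h (join (alg S) a b) \<longleftrightarrow> h a \<or> h b)}) ` (L \<times> L)"
  have "closedin P (\<Inter>\<K>)"
  proof (rule closedin_Inter)
    fix K assume "K \<in> \<K>"
    then consider "K = {h \<in> topspace P. h (one (alg S))}" | "K = {h \<in> topspace P. \<not> h (zero (alg S))}"
      | a b where "a \<in> L" "b \<in> L" "K = {h \<in> topspace P. (h (meet (alg S) a b) \<longleftrightarrow> h a \<and> h b) \<and>
          (h (join (alg S) a b) \<longleftrightarrow> h a \<or> h b)}"
      unfolding \<K>_def by blast
    then have "clopenin P K"
    proof cases
      case 3
      then show ?thesis by (simp only:) (intro And Iff Or ev closed)
    qed (simp_all only: ev Not closed)
    then show "closedin P K" by (simp add: clopenin_def)
  qed (simp add: \<K>_def)
  moreover have "\<Inter>\<K> = Hom2 (alg S)"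
    unfolding \<K>_def Hom2_def top by auto
  ultimately have compact: "compactin P (Hom2 (alg S))" using P closedin_compact_space by simp
  define q where "q = inv_into X (pstar S)"
  have q: "q h \<in> X" "sat S (q h) a \<longleftrightarrow> h a" if "h \<in> Hom2 (alg S)" "a \<in> L" for h a
  proof -
    have h: "h \<in> pstar S ` X" using that pstar_bij by (simp add: bij_betw_def)
    then show "q h \<in> X" unfolding q_def by (rule inv_into_into)
    have "pstar S (q h) = h" unfolding q_def using h by (rule f_inv_into_f)
    then show "sat S (q h) a \<longleftrightarrow> h a" using that(2) by (auto simp: pstar_def dest: fun_cong[of _ _ a])
  qed
  have "continuous_map (subtopology P (Hom2 (alg S))) (extent_topology S) q"
    unfolding continuous_map_def
  proof (intro conjI allI impI)
    show "q \<in> topspace (subtopology P (Hom2 (alg S))) \<rightarrow> topspace (extent_topology S)"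
      using q(1)[OF _ closed(1)] by auto
    fix U assume U: "openin (extent_topology S) U"
    show "openin (subtopology P (Hom2 (alg S))) {h \<in> topspace (subtopology P (Hom2 (alg S))). q h \<in> U}"
    proof (subst openin_subopen, intro ballI)
      fix h assume h: "h \<in> {h \<in> topspace (subtopology P (Hom2 (alg S))). q h \<in> U}"
      then obtain a b where ab: "a \<in> L" "b \<in> L" "sat S (q h) a" "\<not> sat S (q h) b"
        and sub: "\<forall>y \<in> X. sat S y a \<and> \<not> sat S y b \<longrightarrow> y \<in> U"
        using U unfolding openin_extent_topology by blast
      \<comment> \<open>Under \<open>q\<close>, a basic set of the extent topology pulls back to a
        cylinder over the two coordinates \<open>a\<close> and \<open>b\<close>.\<close>
      define W where "W = {h \<in> topspace P. h a \<and> \<not> h b} \<inter> Hom2 (alg S)"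
      have "openin P {h \<in> topspace P. h a \<and> \<not> h b}"
        using And[OF ev[OF ab(1)] Not[OF ev[OF ab(2)]]] by (simp add: clopenin_def)
      then have "openin (subtopology P (Hom2 (alg S))) W"
        unfolding W_def by (rule openin_subtopology_Int)
      moreover have "h \<in> W" using h ab q by (auto simp: W_def)
      moreover have "W \<subseteq> {h \<in> topspace (subtopology P (Hom2 (alg S))). q h \<in> U}"
        using q ab sub by (auto simp: W_def)
      ultimately show "\<exists>T. openin (subtopology P (Hom2 (alg S))) T \<and> h \<in> T \<and>
          T \<subseteq> {h \<in> topspace (subtopology P (Hom2 (alg S))). q h \<in> U}" by blast
    qed
  qed
  then have "compactin (extent_topology S) (q ` Hom2 (alg S))"
    using compact by (meson compactin_subspace compact_space_def image_compactin compactin_subtopology subset_refl)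
  moreover have "q ` Hom2 (alg S) = X"
    unfolding q_def using bij_betw_inv_into[OF pstar_bij] by (simp add: bij_betw_def)
  ultimately show ?thesis by (simp add: compact_space_def)
qed

section \<open>Order, clopen sets, and the Esakia and forest conditions\<close>

lemma extent_order_partial: "partial_order_on X (extent_order S)"
proof -
  have "antisym (extent_order S)"
    by (rule antisymI) (auto simp: extent_order_def intro: point_eqI)
  then show ?thesis
    unfolding partial_order_on_def preorder_on_def refl_on_def trans_def by (auto simp: extent_order_def)
qed

text \<open>The finite unions of differences of extents form a lattice. It separates points:
  distinct points disagree on some \<open>a\<close>, and then the difference of \<open>a\<close> and
  zero, or of one and \<open>a\<close>, contains the first point but not the second. The normal form
  reduces down-closures of clopens to those of single differences.\<close>

lemma clopen_finite_union_basic: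
  assumes "clopenin (extent_topology S) U"
  shows "\<exists>P \<subseteq> L \<times> L. finite P \<and> U = (\<Union>(a, b) \<in> P. {x \<in> X. sat S x a \<and> \<not> sat S x b})"
proof -
  define W where "W = (\<lambda>(a, b). {x \<in> X. sat S x a \<and> \<not> sat S x b})"
  define B where "B = {\<Union>(W ` P) |P. P \<subseteq> L \<times> L \<and> finite P}"
  have B_iff: "V \<in> B \<longleftrightarrow> (\<exists>P. V = \<Union>(W ` P) \<and> P \<subseteq> L \<times> L \<and> finite P)" for V
    unfolding B_def by (rule mem_Collect_eq)
  have clW: "clopenin (extent_topology S) (W p)" if "p \<in> L \<times> L" for p
  proof -
    have "W p = {x \<in> X. sat S x (fst p)} - {x \<in> X. sat S x (snd p)}" by (auto simp: W_def split: prod.splits)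
    then show ?thesis using that clopenin_extent by auto
  qed
  have WB: "W p \<in> B" if "p \<in> L \<times> L" for p
    unfolding B_def using that by (intro CollectI exI[of _ "{p}"]) auto
  have "U \<in> B"
  proof (rule clopenin_mem_separating_lattice[OF compact_space_extent assms])
    show "{} \<in> B" unfolding B_def by (intro CollectI exI[of _ "{}"]) auto
    have "X = W (one (alg S), zero (alg S))" by (auto simp: W_def)
    then show "topspace (extent_topology S) \<in> B" using WB by auto
    show "V \<union> V' \<in> B" if "V \<in> B" "V' \<in> B" for V V'
    proof -
      obtain P P' where "V = \<Union>(W ` P)" "V' = \<Union>(W ` P')" "P \<subseteq> L \<times> L" "finite P" "P' \<subseteq> L \<times> L" "finite P'"
        using \<open>V \<in> B\<close> \<open>V' \<in> B\<close> unfolding B_def by blast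
      then show ?thesis unfolding B_def by (intro CollectI exI[of _ "P \<union> P'"]) auto
    qed
    show "V \<inter> V' \<in> B" if "V \<in> B" "V' \<in> B" for V V'
    proof -
      obtain P P' where V: "V = \<Union>(W ` P)" "V' = \<Union>(W ` P')" "P \<subseteq> L \<times> L" "finite P" "P' \<subseteq> L \<times> L" "finite P'"
        using \<open>V \<in> B\<close> \<open>V' \<in> B\<close> unfolding B_def by blast
      \<comment> \<open>The index of an intersection of two differences: meets of the left entries,
        joins of the right ones.\<close>
      define m where "m = (\<lambda>((a, b), (c, d)). (meet (alg S) a c, join (alg S) b d))"
      have m: "W (m (p, p')) = W p \<inter> W p'" "m (p, p') \<in> L \<times> L" if "p \<in> P" "p' \<in> P'" for p p'
      proof -
        obtain a b c d where p: "p = (a, b)" "p' = (c, d)" by fastforce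
        then have "a \<in> L" "b \<in> L" "c \<in> L" "d \<in> L" using that V by auto
        then show "W (m (p, p')) = W p \<inter> W p'" "m (p, p') \<in> L \<times> L"
          by (auto simp: W_def m_def p)
      qed
      have "V \<inter> V' = \<Union>(W ` m ` (P \<times> P'))"
        unfolding V(1,2) using m(1) by (simp add: image_image case_prod_beta) blast
      moreover have "m ` (P \<times> P') \<subseteq> L \<times> L" using m(2) by blast
      ultimately show ?thesis unfolding B_def using V by (intro CollectI exI[of _ "m ` (P \<times> P')"]) auto
    qed
    show "clopenin (extent_topology S) V" if "V \<in> B" for V
    proof -
      obtain P where V: "V = \<Union>(W ` P)" and P: "P \<subseteq> L \<times> L" and "finite P"
        using \<open>V \<in> B\<close> unfolding B_iff by blast
      from \<open>finite P\<close> P show ?thesis unfolding V by (induction rule: finite_induct) (simp_all add: clW)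
    qed
    show "\<exists>V \<in> B. x \<in> V \<and> y \<notin> V" if "x \<in> U" "y \<in> topspace (extent_topology S) - U" for x y
    proof -
      have "x \<in> topspace (extent_topology S)" using that(1) clopenin_subset[OF assms] by (rule subsetD[rotated])
      then have xy: "x \<in> X" "y \<in> X" "x \<noteq> y" using that by auto
      obtain a where a: "a \<in> L" "sat S x a \<noteq> sat S y a" using point_eqI[OF xy(1,2)] xy(3) by metis
      show ?thesis
      proof (cases "sat S x a")
        case True
        then have "x \<in> W (a, zero (alg S)) \<and> y \<notin> W (a, zero (alg S))" using xy a by (simp add: W_def)
        then show ?thesis using WB[of "(a, zero (alg S))"] a by auto
      next
        case False
        then have "x \<in> W (one (alg S), a) \<and> y \<notin> W (one (alg S), a)" using xy a by (simp add: W_def)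
        then show ?thesis using WB[of "(one (alg S), a)"] a by auto
      qed
    qed
  qed
  then obtain P where "U = \<Union>(W ` P)" "P \<subseteq> L \<times> L" "finite P" unfolding B_iff by blast
  then show ?thesis unfolding W_def by (intro exI[of _ P] conjI)
qed

text \<open>The extents alone form a lattice, and they separate \<open>U\<close> from its
  complement: a point outside an up-set is not above any point inside, so by the definition of the
  order some element is satisfied inside and not outside.\<close>

lemma clopen_up_set_is_extent:
  assumes U: "clopenin (extent_topology S) U"
    and up: "\<And>x y. \<lbrakk>x \<in> U; (x, y) \<in> extent_order S\<rbrakk> \<Longrightarrow> y \<in> U"
  shows "\<exists>a \<in> L. U = {x \<in> X. sat S x a}"
proof -
  define B where "B = (\<lambda>a. {x \<in> X. sat S x a}) ` L"
  have "U \<in> B"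
  proof (rule clopenin_mem_separating_lattice[OF compact_space_extent U])
    show "{} \<in> B" unfolding B_def by (intro image_eqI[of _ _ "zero (alg S)"]) auto
    show "topspace (extent_topology S) \<in> B"
      unfolding B_def by (intro image_eqI[of _ _ "one (alg S)"]) auto
    show "V \<union> V' \<in> B" if V: "V \<in> B" "V' \<in> B" for V V'
    proof -
      obtain a b where "V = {x \<in> X. sat S x a}" "V' = {x \<in> X. sat S x b}" "a \<in> L" "b \<in> L"
        using V unfolding B_def by blast
      then show ?thesis unfolding B_def by (intro image_eqI[of _ _ "join (alg S) a b"]) auto
    qed
    show "V \<inter> V' \<in> B" if V: "V \<in> B" "V' \<in> B" for V V'
    proof -
      obtain a b where "V = {x \<in> X. sat S x a}" "V' = {x \<in> X. sat S x b}" "a \<in> L" "b \<in> L"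
        using V unfolding B_def by blast
      then show ?thesis unfolding B_def by (intro image_eqI[of _ _ "meet (alg S) a b"]) auto
    qed
    show "clopenin (extent_topology S) V" if "V \<in> B" for V
      using that clopenin_extent by (auto simp: B_def)
    show "\<exists>V \<in> B. x \<in> V \<and> y \<notin> V" if "x \<in> U" "y \<in> topspace (extent_topology S) - U" for x y
    proof -
      have xy: "(x, y) \<notin> extent_order S" "x \<in> X" "y \<in> X" using that up clopenin_subset[OF U] by auto
      then obtain a where "a \<in> L" "sat S x a" "\<not> sat S y a" unfolding extent_order_def by blast
      then show ?thesis using xy by (auto simp: B_def)
    qed
  qed
  then show ?thesis by (auto simp: B_def)
qed

lemma esakia_space_space_of: "esakia_space (space_of S)"
  unfolding esakia_space_def space_of_simps topspace_extent
proof (intro conjI ballI allI impI)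
  show "partial_order_on X (extent_order S)" by (rule extent_order_partial)
  show "compact_space (extent_topology S)" by (rule compact_space_extent)
next
  fix x y assume xy: "x \<in> X" "y \<in> X" "(x, y) \<notin> extent_order S"
  then obtain a where "a \<in> L" "sat S x a" "\<not> sat S y a" unfolding extent_order_def by blast
  then show "\<exists>U. clopenin (extent_topology S) U \<and> up_set (space_of S) U \<and> x \<in> U \<and> y \<notin> U"
    using xy clopenin_extent[of a]
    by (intro exI[of _ "{x \<in> X. sat S x a}"]) (auto simp: up_set_def extent_order_def)
next
  fix U assume "clopenin (extent_topology S) U"
  then obtain P where P: "P \<subseteq> L \<times> L" "finite P"
    and U: "U = (\<Union>(a, b) \<in> P. {x \<in> X. sat S x a \<and> \<not> sat S x b})"
    using clopen_finite_union_basic by blast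
  \<comment> \<open>The complement of the extent of an implication is the down-closure of a basic
    difference, by the clause for implication. Down-closure commutes with unions, so the
    down-closure of \<open>U\<close> is a finite union of such clopens.\<close>
  define W where "W = (\<lambda>p. X - {x \<in> X. sat S x (imp (alg S) (fst p) (snd p))})"
  have W: "W p = {x \<in> X. \<exists>y. (x, y) \<in> extent_order S \<and> sat S y (fst p) \<and> \<not> sat S y (snd p)}" if "p \<in> P" for p
  proof -
    have "fst p \<in> L" "snd p \<in> L" using that P(1) by auto
    then show ?thesis unfolding W_def using sat_imp by blast
  qed
  have "down_closure (space_of S) U = \<Union>(W ` P)"
  proof
    show "down_closure (space_of S) U \<subseteq> \<Union>(W ` P)"
    proof
      fix x assume "x \<in> down_closure (space_of S) U"
      then obtain a b y where "(a, b) \<in> P" "x \<in> X" "(x, y) \<in> extent_order S" "sat S y a" "\<not> sat S y b"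
        by (auto simp: U down_closure_def)
      then have "(a, b) \<in> P" "x \<in> W (a, b)" using W by auto
      then show "x \<in> \<Union>(W ` P)" by blast
    qed
    show "\<Union>(W ` P) \<subseteq> down_closure (space_of S) U"
    proof
      fix x assume "x \<in> \<Union>(W ` P)"
      then obtain a b where ab: "(a, b) \<in> P" "x \<in> W (a, b)" by auto
      then obtain y where y: "(x, y) \<in> extent_order S" "sat S y a" "\<not> sat S y b" using W by auto
      then have "x \<in> X" "y \<in> X" by (auto simp: extent_order_def)
      then have "y \<in> U" using ab y unfolding U by blast
      then show "x \<in> down_closure (space_of S) U" using y \<open>x \<in> X\<close> by (auto simp: down_closure_def)
    qed
  qed
  moreover have "clopenin (extent_topology S) (\<Union>(W ` P))"
    using P(2,1)
  proof (induction rule: finite_induct)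
    case (insert p P)
    have "clopenin (extent_topology S) (topspace (extent_topology S) - {x \<in> X. sat S x (imp (alg S) (fst p) (snd p))})"
      using insert.prems by (intro clopenin_closures clopenin_extent) auto
    then show ?case using insert by (simp add: W_def)
  qed simp
  ultimately show "clopenin (extent_topology S) (down_closure (space_of S) U)" by simp
qed

text \<open>Incomparable \<open>y\<close> and \<open>z\<close> above \<open>x\<close> provide
  \<open>a\<close> satisfied only at \<open>y\<close> and \<open>b\<close> satisfied only at
  \<open>z\<close>. Then \<open>y\<close> witnesses that \<open>x\<close> refutes
  \<open>a \<rightarrow> b\<close>, and \<open>z\<close> that it refutes
  \<open>b \<rightarrow> a\<close>, against prelinearity.\<close>

lemma forest_space_of: "forest (space_of S)"
  unfolding forest_def total_on_def space_of_simps topspace_extent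
proof (intro ballI impI, rule ccontr)
  fix x y z assume x: "x \<in> X" and y: "y \<in> {y \<in> X. (x, y) \<in> extent_order S}"
    and z: "z \<in> {y \<in> X. (x, y) \<in> extent_order S}"
    and neg: "\<not> ((y, z) \<in> extent_order S \<or> (z, y) \<in> extent_order S)"
  obtain a where a: "a \<in> L" "sat S y a" "\<not> sat S z a" using y z neg unfolding extent_order_def by blast
  obtain b where b: "b \<in> L" "sat S z b" "\<not> sat S y b" using y z neg unfolding extent_order_def by blast
  have "join (alg S) (imp (alg S) a b) (imp (alg S) b a) = one (alg S)"
    using goedel a b by (simp add: goedel_algebra_def)
  then have "sat S x (imp (alg S) a b) \<or> sat S x (imp (alg S) b a)"
    using x a b sat_one[OF x] by (metis imp_closed sat_join)
  then show False using x y z a b by (auto simp: sat_imp)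
qed

end

subsection \<open>Morphisms\<close>

text \<open>Continuity and monotonicity hold because the preimage of the extent of \<open>b\<close>
  is the extent of \<open>f2 b\<close>. The back condition is the substantial part: it needs
  compactness, and it is where \<open>f2\<close> must preserve implication.\<close>

lemma GI_hom_esakia_hom:
  assumes S: "GI_system S" and T: "GI_system T" and f: "(f1, f2) \<in> GI_hom S T"
  shows "f1 \<in> esakia_hom (space_of S) (space_of T)"
proof -
  interpret S: gi_system S by unfold_locales (fact S)
  interpret T: gi_system T by unfold_locales (fact T)
  have f1: "f1 \<in> extensional S.X" "\<And>x. x \<in> S.X \<Longrightarrow> f1 x \<in> T.X"
    using f by (auto simp: GI_hom_def PiE_def)
  have f2: "f2 b \<in> S.L" if "b \<in> T.L" for b using f that by (auto simp: GI_hom_def heyting_hom_def)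
  have f2_imp: "f2 (imp (alg T) a b) = imp (alg S) (f2 a) (f2 b)" if "a \<in> T.L" "b \<in> T.L" for a b
    using f that by (auto simp: GI_hom_def heyting_hom_def)
  have sat: "sat S x (f2 b) \<longleftrightarrow> sat T (f1 x) b" if "x \<in> S.X" "b \<in> T.L" for x b
    using f that by (auto simp: GI_hom_def)
  have cont: "continuous_map (extent_topology S) (extent_topology T) f1"
    unfolding continuous_map_def
  proof (intro conjI allI impI)
    fix U assume U: "openin (extent_topology T) U"
    show "openin (extent_topology S) {x \<in> topspace (extent_topology S). f1 x \<in> U}"
      unfolding S.openin_extent_topology
    proof (intro conjI ballI)
      fix x assume x: "x \<in> {x \<in> topspace (extent_topology S). f1 x \<in> U}"
      then obtain a b where ab: "a \<in> T.L" "b \<in> T.L" "sat T (f1 x) a" "\<not> sat T (f1 x) b"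
        "\<forall>y \<in> T.X. sat T y a \<and> \<not> sat T y b \<longrightarrow> y \<in> U"
        using U unfolding T.openin_extent_topology by blast
      show "\<exists>a \<in> S.L. \<exists>b \<in> S.L. sat S x a \<and> \<not> sat S x b \<and> (\<forall>y \<in> S.X. sat S y a \<and> \<not> sat S y b \<longrightarrow>
          y \<in> {x \<in> topspace (extent_topology S). f1 x \<in> U})"
        by (rule bexI[of _ "f2 a"], rule bexI[of _ "f2 b"]) (use x ab f1 f2 sat in auto)
    qed auto
  qed (use f1 in auto)
  have mono: "(f1 x, f1 y) \<in> extent_order T" if "(x, y) \<in> extent_order S" for x y
    using that f1 f2 sat unfolding extent_order_def by blast
  have lift: "\<exists>z \<in> S.X. (x, z) \<in> extent_order S \<and> f1 z = y"
    if x: "x \<in> S.X" and y: "y \<in> T.X" and xy: "(f1 x, y) \<in> extent_order T" for x y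
  proof (rule ccontr)
    assume neg: "\<not> ?thesis"
    \<comment> \<open>As an intersection of extents the principal up-set of \<open>x\<close> is
      closed; inserting \<open>S.X\<close> makes the family visibly nonempty.\<close>
    define K where "K = \<Inter>(insert S.X ((\<lambda>a. {z \<in> S.X. sat S z a}) ` {a \<in> S.L. sat S x a}))"
    have K: "K = {z. (x, z) \<in> extent_order S}" using x by (auto simp: K_def extent_order_def)
    have "closedin (extent_topology S) K" unfolding K_def
    proof (rule closedin_Inter)
      fix C assume "C \<in> insert S.X ((\<lambda>a. {z \<in> S.X. sat S z a}) ` {a \<in> S.L. sat S x a})"
      then have "clopenin (extent_topology S) C"
        using S.clopenin_extent clopenin_closures(2)[of "extent_topology S"] by auto
      then show "closedin (extent_topology S) C" by (simp add: clopenin_def)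
    qed simp
    text \<open>
      If no \<open>z\<close> above \<open>x\<close> is mapped to \<open>y\<close>, then the closed set \<open>K\<close> of points above \<open>x\<close> is covered by the
      directed family of preimages of \<open>c \<Rightarrow> b\<close> with \<open>y\<close> satisfying \<open>c\<close> but not \<open>b\<close>, hence by one of them;
      but then \<open>f1 x\<close> satisfies \<open>c \<rightarrow> b\<close>, contradicting \<open>f1 x \<le> y\<close>.
    \<close>
    define B where "B = {{z \<in> S.X. sat T (f1 z) c \<longrightarrow> sat T (f1 z) b} |b c.
      b \<in> T.L \<and> c \<in> T.L \<and> \<not> sat T y b \<and> sat T y c}"
    have BI: "{z \<in> S.X. sat T (f1 z) c \<longrightarrow> sat T (f1 z) b} \<in> B"
      if "b \<in> T.L" "c \<in> T.L" "\<not> sat T y b" "sat T y c" for b c using that by (auto simp: B_def)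
    have "\<exists>U \<in> B. K \<subseteq> U"
    proof (rule closedin_subset_directed_cover[OF S.compact_space_extent])
      show "closedin (extent_topology S) K" by fact
      \<comment> \<open>The empty set is the member for the implication from one to zero, which no
        point fulfils.\<close>
      have "{z \<in> S.X. sat T (f1 z) (one (alg T)) \<longrightarrow> sat T (f1 z) (zero (alg T))} = {}"
        using f1 by auto
      moreover have "{z \<in> S.X. sat T (f1 z) (one (alg T)) \<longrightarrow> sat T (f1 z) (zero (alg T))} \<in> B"
        using y by (intro BI) auto
      ultimately show "{} \<in> B" by (simp only:)
    next
      fix U V assume "U \<in> B" "V \<in> B"
      then obtain b c b' c' where U: "U = {z \<in> S.X. sat T (f1 z) c \<longrightarrow> sat T (f1 z) b}"
        and V: "V = {z \<in> S.X. sat T (f1 z) c' \<longrightarrow> sat T (f1 z) b'}"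
        and bc: "b \<in> T.L" "c \<in> T.L" "\<not> sat T y b" "sat T y c" "b' \<in> T.L" "c' \<in> T.L" "\<not> sat T y b'" "sat T y c'"
        unfolding B_def by blast
      have "U \<union> V = {z \<in> S.X. sat T (f1 z) (meet (alg T) c c') \<longrightarrow> sat T (f1 z) (join (alg T) b b')}"
        unfolding U V using f1 bc by auto
      then show "U \<union> V \<in> B" using BI[of "join (alg T) b b'" "meet (alg T) c c'"] bc y by simp
    next
      fix U assume "U \<in> B"
      then obtain b c where U: "U = {z \<in> S.X. sat T (f1 z) c \<longrightarrow> sat T (f1 z) b}" and bc: "b \<in> T.L" "c \<in> T.L"
        unfolding B_def by blast
      have "U = (topspace (extent_topology S) - {z \<in> S.X. sat S z (f2 c)}) \<union> {z \<in> S.X. sat S z (f2 b)}"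
        unfolding U using sat bc by auto
      also have "clopenin (extent_topology S) \<dots>"
        using bc f2 by (intro clopenin_closures S.clopenin_extent)
      finally show "openin (extent_topology S) U" by (simp add: clopenin_def)
    next
      fix z assume "z \<in> K"
      then have z: "z \<in> S.X" "f1 z \<noteq> y" using neg by (auto simp: K extent_order_def)
      then obtain a where a: "a \<in> T.L" "sat T (f1 z) a \<noteq> sat T y a" using T.point_eqI y f1 by blast
      \<comment> \<open>The element \<open>a\<close> tells \<open>f1 z\<close> and \<open>y\<close>
        apart. If \<open>y\<close> satisfies it, the implication from \<open>a\<close> to zero
        covers \<open>z\<close>; otherwise the one from one to \<open>a\<close> does.\<close>
      show "\<exists>U \<in> B. z \<in> U"
      proof (cases "sat T y a")
        case True
        then show ?thesis using a z y f1 by (intro bexI[OF _ BI[of "zero (alg T)" a]]) auto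
      next
        case False
        then show ?thesis using a z y f1 by (intro bexI[OF _ BI[of a "one (alg T)"]]) auto
      qed
    qed
    then obtain b c where bc: "b \<in> T.L" "c \<in> T.L" "\<not> sat T y b" "sat T y c"
      and sub: "K \<subseteq> {z \<in> S.X. sat T (f1 z) c \<longrightarrow> sat T (f1 z) b}" unfolding B_def by blast
    have "sat S x (imp (alg S) (f2 c) (f2 b))"
      using x bc f2 sub sat by (auto simp: S.sat_imp K)
    then have "sat T (f1 x) (imp (alg T) c b)" 
      using sat[OF x T.imp_closed[OF bc(2,1)]] by (simp add: f2_imp bc)
    then show False using T.sat_imp f1 x bc xy by blast
  qed
  show ?thesis
    unfolding esakia_hom_def using f1 cont mono lift by simp
qed

text \<open>The first component fixes the extent of every value of the second, and extents determine
  elements. This gives faithfulness, and it reduces every equation between arrows of systems to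
  first components.\<close>

lemma GI_hom_eqI:
  assumes "GI_system S" and f: "f \<in> GI_hom S T" and g: "g \<in> GI_hom S T" and eq: "fst f = fst g"
  shows "f = g"
proof -
  interpret S: gi_system S by unfold_locales (fact assms(1))
  have "snd f = snd g"
  proof (rule PiE_ext)
    show "snd f \<in> carrier (alg T) \<rightarrow>\<^sub>E S.L" "snd g \<in> carrier (alg T) \<rightarrow>\<^sub>E S.L"
      using f g by (auto simp: GI_hom_def heyting_hom_def)
    then show "snd f b = snd g b" if "b \<in> carrier (alg T)" for b
      using that f g eq by (intro S.extent_inject) (auto simp: GI_hom_def)
  qed
  with eq show ?thesis by (simp add: prod_eq_iff)
qed

text \<open>The preimage of an extent under \<open>f\<close> is a clopen up-set, hence again an
  extent; the element it belongs to is the value of the second component. Preservation of the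
  operations is then checked on extents.\<close>

lemma esakia_hom_lift:
  assumes S: "GI_system S" and T: "GI_system T" and f: "f \<in> esakia_hom (space_of S) (space_of T)"
  shows "\<exists>f2. (f, f2) \<in> GI_hom S T"
proof -
  interpret S: gi_system S by unfold_locales (fact S)
  interpret T: gi_system T by unfold_locales (fact T)
  have ext: "f \<in> extensional S.X" and cont: "continuous_map (extent_topology S) (extent_topology T) f"
    using f by (auto simp: esakia_hom_def)
  have fX: "f x \<in> T.X" if "x \<in> S.X" for x
    using continuous_map_image_subset_topspace[OF cont] that by auto
  have mono: "(f x, f y) \<in> extent_order T" if "(x, y) \<in> extent_order S" for x y
    using f that by (auto simp: esakia_hom_def extent_order_def)
  have lift: "\<exists>z. (x, z) \<in> extent_order S \<and> f z = y" if "x \<in> S.X" "(f x, y) \<in> extent_order T" for x y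
  proof -
    have "y \<in> T.X" using that by (auto simp: extent_order_def)
    moreover have "\<forall>x \<in> S.X. \<forall>y \<in> T.X. (f x, y) \<in> extent_order T \<longrightarrow>
        (\<exists>z \<in> S.X. (x, z) \<in> extent_order S \<and> f z = y)"
      using f by (simp add: esakia_hom_def)
    ultimately show ?thesis using that by blast
  qed
  have extent: "\<exists>a \<in> S.L. {x \<in> S.X. sat T (f x) b} = {x \<in> S.X. sat S x a}" if b: "b \<in> T.L" for b
  proof (rule S.clopen_up_set_is_extent)
    have "{x \<in> S.X. sat T (f x) b} = {x \<in> topspace (extent_topology S). f x \<in> {y \<in> T.X. sat T y b}}"
      using fX by auto
    then show "clopenin (extent_topology S) {x \<in> S.X. sat T (f x) b}"
      using T.clopenin_extent[OF b] openin_continuous_map_preimage[OF cont]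
        closedin_continuous_map_preimage[OF cont] unfolding clopenin_def by (simp only:)
    show "y \<in> {x \<in> S.X. sat T (f x) b}" if "x \<in> {x \<in> S.X. sat T (f x) b}" "(x, y) \<in> extent_order S" for x y
      using that mono[OF that(2)] b by (auto simp: extent_order_def)
  qed
  have "\<exists>a \<in> S.L. \<forall>x \<in> S.X. sat S x a \<longleftrightarrow> sat T (f x) b" if "b \<in> T.L" for b
    using extent[OF that] by blast
  then obtain g where g: "\<And>b. b \<in> T.L \<Longrightarrow> g b \<in> S.L"
    "\<And>b x. b \<in> T.L \<Longrightarrow> x \<in> S.X \<Longrightarrow> sat S x (g b) \<longleftrightarrow> sat T (f x) b" by metis
  have imp: "g (imp (alg T) a b) = imp (alg S) (g a) (g b)" if "a \<in> T.L" "b \<in> T.L" for a b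
  proof (rule S.extent_inject)
    fix x assume x: "x \<in> S.X"
    \<comment> \<open>The points above \<open>f x\<close> are exactly the images of the points above
      \<open>x\<close>: one inclusion is monotonicity, the other the back condition.\<close>
    have "sat T (f x) (imp (alg T) a b) \<longleftrightarrow> (\<forall>z. (x, z) \<in> extent_order S \<longrightarrow> sat T (f z) a \<longrightarrow> sat T (f z) b)"
      using T.sat_imp[OF fX[OF x] that] mono lift[OF x] by blast
    also have "\<dots> \<longleftrightarrow> (\<forall>z. (x, z) \<in> extent_order S \<longrightarrow> sat S z (g a) \<longrightarrow> sat S z (g b))"
      using g(2) that by (auto simp: extent_order_def)
    finally show "sat S x (g (imp (alg T) a b)) \<longleftrightarrow> sat S x (imp (alg S) (g a) (g b))"
      using g that x by (simp add: S.sat_imp)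
  qed (use g that in auto)
  have "g (meet (alg T) a b) = meet (alg S) (g a) (g b)" "g (join (alg T) a b) = join (alg S) (g a) (g b)"
    if "a \<in> T.L" "b \<in> T.L" for a b
    using that g fX by (auto intro!: S.extent_inject)
  moreover have "g (zero (alg T)) = zero (alg S)" using g fX by (intro S.extent_inject) auto
  ultimately have "(f, restrict g T.L) \<in> GI_hom S T"
    using imp g ext fX by (auto simp: GI_hom_def heyting_hom_def PiE_def)
  then show ?thesis by blast
qed

subsection \<open>The system of an Esakia forest\<close>

definition clopen_ups :: "'x ordered_space \<Rightarrow> 'x set set" where
  "clopen_ups E = {U. clopenin (topology_of E) U \<and> up_set E U}"

text \<open>The map \<open>e\<close> is an arbitrary injective naming of the clopen up-sets by
  elements of \<open>'a\<close>; all algebraic structure is transported along it, while the points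
  remain those of \<open>E\<close>.\<close>

locale coded_esakia_space =
  fixes E :: "'x ordered_space" and e :: "'x set \<Rightarrow> 'a"
  assumes esakia: "esakia_space E" and forest: "forest E" and ne: "pts E \<noteq> {}"
    and inj: "inj_on e (clopen_ups E)"
begin

abbreviation "d \<equiv> inv_into (clopen_ups E) e"

text \<open>The implication of \<open>U\<close> and \<open>V\<close> is the set of points all of
  whose successors in \<open>U\<close> lie in \<open>V\<close>, the largest up-set meeting
  \<open>U\<close> inside \<open>V\<close>. Written as the complement of a down-closure it is clopen
  by the Esakia condition.\<close>

definition coded_algebra :: "'a heyting" where
  "coded_algebra = \<lparr>carrier = e ` clopen_ups E,
     join = (\<lambda>a b. e (d a \<union> d b)), meet = (\<lambda>a b. e (d a \<inter> d b)),
     imp = (\<lambda>a b. e (pts E - down_closure E (d a - d b))),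
     one = e (pts E), zero = e {}\<rparr>"

definition coded_system :: "('x, 'a) system" where
  "coded_system = \<lparr>points = pts E, sat = (\<lambda>x a. x \<in> d a), alg = coded_algebra\<rparr>"

section \<open>Clopen up-sets and their coded algebra\<close>

lemma d_e [simp]: "U \<in> clopen_ups E \<Longrightarrow> d (e U) = U"
  using inj by simp

lemma e_eq_iff [simp]: "\<lbrakk>U \<in> clopen_ups E; V \<in> clopen_ups E\<rbrakk> \<Longrightarrow> e U = e V \<longleftrightarrow> U = V"
  using inj by (simp add: inj_on_eq_iff)

lemma compact: "compact_space (topology_of E)" and partial_order: "partial_order_on (pts E) (ord E)"
  using esakia by (auto simp: esakia_space_def)

lemma order_refl: "x \<in> pts E \<Longrightarrow> (x, x) \<in> ord E"
  and order_trans: "\<lbrakk>(x, y) \<in> ord E; (y, z) \<in> ord E\<rbrakk> \<Longrightarrow> (x, z) \<in> ord E"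
  and order_antisym: "\<lbrakk>(x, y) \<in> ord E; (y, x) \<in> ord E\<rbrakk> \<Longrightarrow> x = y"
  using partial_order_onD(1-3)[OF partial_order] by (blast dest: refl_onD transD antisymD)+

lemma order_field: "(x, y) \<in> ord E \<Longrightarrow> x \<in> pts E \<and> y \<in> pts E"
  using partial_order_onD(4)[OF partial_order] by auto

lemma clopen_ups_subset: "U \<in> clopen_ups E \<Longrightarrow> U \<subseteq> pts E"
  by (simp add: clopen_ups_def up_set_def)

lemma clopen_ups_clopen: "U \<in> clopen_ups E \<Longrightarrow> clopenin (topology_of E) U"
  by (simp add: clopen_ups_def)

lemma clopen_ups_up: "\<lbrakk>U \<in> clopen_ups E; x \<in> U; (x, y) \<in> ord E\<rbrakk> \<Longrightarrow> y \<in> U"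
  using order_field by (auto simp: clopen_ups_def up_set_def)

lemma clopen_upsI:
  assumes "clopenin (topology_of E) U" "\<And>x y. \<lbrakk>x \<in> U; (x, y) \<in> ord E\<rbrakk> \<Longrightarrow> y \<in> U"
  shows "U \<in> clopen_ups E"
  using assms clopenin_subset[OF assms(1)] by (auto simp: clopen_ups_def up_set_def)

lemma clopen_ups_closed [simp]:
  "{} \<in> clopen_ups E" "pts E \<in> clopen_ups E"
  "\<lbrakk>U \<in> clopen_ups E; V \<in> clopen_ups E\<rbrakk> \<Longrightarrow> U \<union> V \<in> clopen_ups E"
  "\<lbrakk>U \<in> clopen_ups E; V \<in> clopen_ups E\<rbrakk> \<Longrightarrow> U \<inter> V \<in> clopen_ups E"
proof -
  show "{} \<in> clopen_ups E" by (rule clopen_upsI) auto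
  show "pts E \<in> clopen_ups E" by (rule clopen_upsI) (auto dest: order_field)
  assume UV: "U \<in> clopen_ups E" "V \<in> clopen_ups E"
  show "U \<union> V \<in> clopen_ups E"
    by (rule clopen_upsI) (use UV clopen_ups_up in \<open>auto simp: clopen_ups_clopen\<close>)
  show "U \<inter> V \<in> clopen_ups E"
    by (rule clopen_upsI) (use UV clopen_ups_up in \<open>auto simp: clopen_ups_clopen\<close>)
qed

lemma in_imp_iff:
  "x \<in> pts E - down_closure E (U - V) \<longleftrightarrow>
    x \<in> pts E \<and> (\<forall>y. (x, y) \<in> ord E \<longrightarrow> y \<in> U \<longrightarrow> y \<in> V)"
  by (auto simp: down_closure_def)

lemma imp_clopen_up [simp]:
  assumes "U \<in> clopen_ups E" "V \<in> clopen_ups E"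
  shows "pts E - down_closure E (U - V) \<in> clopen_ups E"
proof (rule clopen_upsI)
  have "clopenin (topology_of E) (U - V)"
    using assms by (simp add: clopen_ups_clopen)
  then have "clopenin (topology_of E) (down_closure E (U - V))"
    using esakia by (simp add: esakia_space_def)
  then show "clopenin (topology_of E) (pts E - down_closure E (U - V))" by simp
  show "y \<in> pts E - down_closure E (U - V)"
    if "x \<in> pts E - down_closure E (U - V)" "(x, y) \<in> ord E" for x y
    using that order_trans[OF that(2)] order_field[OF that(2)] unfolding in_imp_iff by blast
qed

lemma separation:
  assumes "x \<in> pts E" "y \<in> pts E" "(x, y) \<notin> ord E"
  shows "\<exists>U \<in> clopen_ups E. x \<in> U \<and> y \<notin> U"
  using assms esakia by (auto simp: esakia_space_def clopen_ups_def)

lemma ord_iff_clopen_ups: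
  assumes "x \<in> pts E" "y \<in> pts E"
  shows "(x, y) \<in> ord E \<longleftrightarrow> (\<forall>U \<in> clopen_ups E. x \<in> U \<longrightarrow> y \<in> U)"
proof
  show "\<forall>U \<in> clopen_ups E. x \<in> U \<longrightarrow> y \<in> U" if "(x, y) \<in> ord E"
    using that clopen_ups_up by blast
  show "(x, y) \<in> ord E" if "\<forall>U \<in> clopen_ups E. x \<in> U \<longrightarrow> y \<in> U"
    using that separation[OF assms] by blast
qed

lemma carrier_coded: "carrier coded_algebra = e ` clopen_ups E"
  and one_coded: "one coded_algebra = e (pts E)" and zero_coded: "zero coded_algebra = e {}"
  by (simp_all add: coded_algebra_def)

lemma ops_coded:
  assumes "U \<in> clopen_ups E" "V \<in> clopen_ups E"
  shows "join coded_algebra (e U) (e V) = e (U \<union> V)" "meet coded_algebra (e U) (e V) = e (U \<inter> V)"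
    "imp coded_algebra (e U) (e V) = e (pts E - down_closure E (U - V))"
  using assms by (simp_all add: coded_algebra_def)

lemmas coded_simps = carrier_coded one_coded zero_coded ops_coded

lemma le_coded: "\<lbrakk>U \<in> clopen_ups E; V \<in> clopen_ups E\<rbrakk> \<Longrightarrow> le coded_algebra (e U) (e V) \<longleftrightarrow> U \<subseteq> V"
  by (auto simp: le_def coded_simps)

lemma coded_bdl: "bounded_distributive_lattice coded_algebra"
  unfolding bounded_distributive_lattice_def carrier_coded ball_simps
  by (intro conjI ballI) (use clopen_ups_subset in \<open>auto simp: coded_simps\<close>)

lemma coded_heyting: "heyting_algebra coded_algebra"
  unfolding heyting_algebra_def
proof (intro conjI coded_bdl ballI; unfold carrier_coded)
  fix a b assume "a \<in> e ` clopen_ups E" "b \<in> e ` clopen_ups E"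
  then show "imp coded_algebra a b \<in> e ` clopen_ups E" by (auto simp: coded_simps)
next
  fix a b c assume "a \<in> e ` clopen_ups E" "b \<in> e ` clopen_ups E" "c \<in> e ` clopen_ups E"
  then obtain U V W where abc: "a = e U" "b = e V" "c = e W"
    and UVW: "U \<in> clopen_ups E" "V \<in> clopen_ups E" "W \<in> clopen_ups E" by blast
  \<comment> \<open>The forward direction uses that \<open>W\<close> is an up-set, the backward one
    reflexivity of the order.\<close>
  have "W \<inter> U \<subseteq> V \<longleftrightarrow> W \<subseteq> pts E - down_closure E (U - V)"
  proof
    assume "W \<inter> U \<subseteq> V"
    then show "W \<subseteq> pts E - down_closure E (U - V)"
      using clopen_ups_subset[OF UVW(3)] clopen_ups_up[OF UVW(3)] unfolding subset_iff in_imp_iff by blast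
  next
    assume "W \<subseteq> pts E - down_closure E (U - V)"
    then show "W \<inter> U \<subseteq> V"
      using clopen_ups_subset[OF UVW(3)] order_refl unfolding subset_iff in_imp_iff by blast
  qed
  then show "le coded_algebra (meet coded_algebra c a) b \<longleftrightarrow> le coded_algebra c (imp coded_algebra a b)"
    using UVW by (simp add: abc ops_coded le_coded)
qed

text \<open>A point outside both implications has a successor in \<open>U\<close> outside
  \<open>V\<close> and one in \<open>V\<close> outside \<open>U\<close>. The forest condition makes
  these comparable, and then one of the up-sets contains both.\<close>

lemma coded_goedel: "goedel_algebra coded_algebra"
  unfolding goedel_algebra_def
proof (intro conjI coded_heyting ballI; unfold carrier_coded)
  fix a b assume "a \<in> e ` clopen_ups E" "b \<in> e ` clopen_ups E"
  then obtain U V where ab: "a = e U" "b = e V"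
    and UV: "U \<in> clopen_ups E" "V \<in> clopen_ups E" by blast
  have "x \<in> (pts E - down_closure E (U - V)) \<union> (pts E - down_closure E (V - U))" if x: "x \<in> pts E" for x
  proof (rule ccontr)
    assume "\<not> ?thesis"
    then obtain y z where y: "(x, y) \<in> ord E" "y \<in> U" "y \<notin> V" and z: "(x, z) \<in> ord E" "z \<in> V" "z \<notin> U"
      using x unfolding Un_iff in_imp_iff by blast
    have "y \<noteq> z" using y z by blast
    then have "(y, z) \<in> ord E \<or> (z, y) \<in> ord E"
      using forest x y z order_field unfolding forest_def total_on_def by blast
    then show False using y z UV clopen_ups_up by blast
  qed
  then have "(pts E - down_closure E (U - V)) \<union> (pts E - down_closure E (V - U)) = pts E" by blast
  then show "join coded_algebra (imp coded_algebra a b) (imp coded_algebra b a) = one coded_algebra"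
    using UV by (simp add: ab coded_simps)
qed

section \<open>Points as homomorphisms, and recovery of the space\<close>

lemma coded_system_simps [simp]:
  "points coded_system = pts E" "alg coded_system = coded_algebra" "sat coded_system x a \<longleftrightarrow> x \<in> d a"
  by (simp_all add: coded_system_def)

lemma pstar_coded_inj: "inj_on (pstar coded_system) (pts E)"
proof (rule inj_onI)
  fix x y assume xy: "x \<in> pts E" "y \<in> pts E" "pstar coded_system x = pstar coded_system y"
  have "x \<in> U \<longleftrightarrow> y \<in> U" if "U \<in> clopen_ups E" for U
    using fun_cong[OF xy(3), of "e U"] that by (simp add: pstar_def carrier_coded)
  then have "(x, y) \<in> ord E" "(y, x) \<in> ord E"
    using ord_iff_clopen_ups[OF xy(1,2)] ord_iff_clopen_ups[OF xy(2,1)] by auto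
  then show "x = y" by (rule order_antisym)
qed

text \<open>If no point realizes \<open>h\<close>, the sets \<open>V \<union> (pts E - U)\<close>
  with \<open>U\<close> accepted and \<open>V\<close> rejected by \<open>h\<close> cover the space.
  They are directed, since \<open>h\<close> accepts intersections of accepted sets and rejects
  unions of rejected ones. A single one covering everything means that \<open>U\<close> lies inside
  \<open>V\<close>, which \<open>h\<close> forbids.\<close>

lemma pstar_coded_surj:
  assumes h: "h \<in> Hom2 coded_algebra"
  shows "\<exists>x \<in> pts E. h = pstar coded_system x"
proof -
  have h_Un: "h (e (U \<union> V)) \<longleftrightarrow> h (e U) \<or> h (e V)" and h_Int: "h (e (U \<inter> V)) \<longleftrightarrow> h (e U) \<and> h (e V)"
    if "U \<in> clopen_ups E" "V \<in> clopen_ups E" for U V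
    using h that by (auto simp: Hom2_def carrier_coded ops_coded)
  have h1: "h (e (pts E))" and h0: "\<not> h (e {})"
    using h by (auto simp: Hom2_def one_coded zero_coded)
  have "\<exists>x \<in> pts E. \<forall>U \<in> clopen_ups E. h (e U) \<longleftrightarrow> x \<in> U"
  proof (rule ccontr)
    assume neg: "\<not> ?thesis"
    define B where "B = {V \<union> (pts E - U) |U V. U \<in> clopen_ups E \<and> V \<in> clopen_ups E \<and> h (e U) \<and> \<not> h (e V)}"
    have BI: "V \<union> (pts E - U) \<in> B"
      if "U \<in> clopen_ups E" "V \<in> clopen_ups E" "h (e U)" "\<not> h (e V)" for U V
      using that unfolding B_def by blast
    have "\<exists>W \<in> B. pts E \<subseteq> W"
    proof (rule closedin_subset_directed_cover[OF compact])
      show "{} \<in> B" using BI[of "pts E" "{}"] h0 h1 by simp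
    next
      fix W W' assume "W \<in> B" "W' \<in> B"
      then obtain U V U' V' where W: "W = V \<union> (pts E - U)" "W' = V' \<union> (pts E - U')"
        and UV: "U \<in> clopen_ups E" "V \<in> clopen_ups E" "h (e U)" "\<not> h (e V)"
          "U' \<in> clopen_ups E" "V' \<in> clopen_ups E" "h (e U')" "\<not> h (e V')"
        unfolding B_def by blast
      have "W \<union> W' = (V \<union> V') \<union> (pts E - U \<inter> U')" unfolding W by blast
      then show "W \<union> W' \<in> B" using BI[of "U \<inter> U'" "V \<union> V'"] UV by (simp add: h_Un h_Int)
    next
      fix W assume "W \<in> B"
      then obtain U V where "W = V \<union> (pts E - U)" "U \<in> clopen_ups E" "V \<in> clopen_ups E"
        unfolding B_def by blast
      then have "clopenin (topology_of E) W" by (simp add: clopen_ups_clopen)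
      then show "openin (topology_of E) W" by (simp add: clopenin_def)
    next
      fix x assume x: "x \<in> pts E"
      then obtain U where U: "U \<in> clopen_ups E" "h (e U) \<noteq> (x \<in> U)" using neg by blast
      \<comment> \<open>An accepted set missing \<open>x\<close> is paired with \<open>{}\<close>, a
        rejected set containing \<open>x\<close> with the whole space.\<close>
      show "\<exists>W \<in> B. x \<in> W"
      proof (cases "h (e U)")
        case True
        then show ?thesis using U x h0 by (intro bexI[OF _ BI[of U "{}"]]) auto
      next
        case False
        then show ?thesis using U x h1 by (intro bexI[OF _ BI[of "pts E" U]]) auto
      qed
    qed simp
    then obtain U V where UV: "U \<in> clopen_ups E" "V \<in> clopen_ups E" "h (e U)" "\<not> h (e V)"
      and "pts E \<subseteq> V \<union> (pts E - U)" unfolding B_def by blast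
    then have "U \<union> V = V" using clopen_ups_subset by blast
    then show False using h_Un[OF UV(1,2)] UV by simp
  qed
  then obtain x where x: "x \<in> pts E" "\<And>U. U \<in> clopen_ups E \<Longrightarrow> h (e U) \<longleftrightarrow> x \<in> U" by blast
  have "h = pstar coded_system x"
  proof (rule extensionalityI)
    show "h \<in> extensional (e ` clopen_ups E)" using h by (simp add: Hom2_def carrier_coded)
    show "pstar coded_system x \<in> extensional (e ` clopen_ups E)" by (simp add: pstar_def carrier_coded)
  qed (use x in \<open>auto simp: pstar_def carrier_coded\<close>)
  with x show ?thesis by blast
qed

lemma pstar_coded_Hom2:
  assumes "x \<in> pts E"
  shows "pstar coded_system x \<in> Hom2 coded_algebra"
  using assms by (auto simp: Hom2_def pstar_def coded_simps)

lemma R_pstar_coded: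
  assumes "x \<in> pts E" "y \<in> pts E"
  shows "R coded_algebra (pstar coded_system x) (pstar coded_system y) \<longleftrightarrow> (x, y) \<in> ord E"
  unfolding ord_iff_clopen_ups[OF assms] by (auto simp: R_def pstar_def carrier_coded)

lemma coded_GI_system: "GI_system coded_system"
  unfolding GI_system_def Let_def coded_system_simps
proof (intro conjI ballI)
  fix x a b assume x: "x \<in> pts E" and "a \<in> carrier coded_algebra" "b \<in> carrier coded_algebra"
  then obtain U V where ab: "a = e U" "b = e V" and UV: "U \<in> clopen_ups E" "V \<in> clopen_ups E"
    by (auto simp: carrier_coded)
  show "x \<in> d (meet coded_algebra a b) \<longleftrightarrow> x \<in> d a \<and> x \<in> d b"
    and "x \<in> d (join coded_algebra a b) \<longleftrightarrow> x \<in> d a \<or> x \<in> d b"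
    using UV by (simp_all add: ab ops_coded)
  have "d (imp coded_algebra a b) = pts E - down_closure E (U - V)"
    using UV by (simp add: ab ops_coded)
  then show "x \<in> d (imp coded_algebra a b) \<longleftrightarrow> (\<forall>y \<in> pts E.
      R coded_algebra (pstar coded_system x) (pstar coded_system y) \<longrightarrow> y \<notin> d a \<or> y \<in> d b)"
    using x UV order_field R_pstar_coded[OF x] unfolding ab by (auto simp: in_imp_iff simp del: Diff_iff)
next
  show "bij_betw (pstar coded_system) (pts E) (Hom2 coded_algebra)"
    unfolding bij_betw_def using pstar_coded_inj pstar_coded_surj pstar_coded_Hom2 by blast
qed (use ne coded_goedel zero_coded in auto)

text \<open>The order is recovered because clopen up-sets detect it. For the topology, differences
  of clopen up-sets are open in \<open>E\<close>, and since they separate points, compactness makes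
  them a base.\<close>

lemma space_of_coded_system: "space_of coded_system = E"
proof -
  interpret C: gi_system coded_system by unfold_locales (rule coded_GI_system)
  have "extent_order coded_system = ord E"
  proof (rule set_eqI)
    fix p :: "'x \<times> 'x"
    obtain x y where p: "p = (x, y)" by fastforce
    have "p \<in> extent_order coded_system \<longleftrightarrow>
        x \<in> pts E \<and> y \<in> pts E \<and> (\<forall>U \<in> clopen_ups E. x \<in> U \<longrightarrow> y \<in> U)"
      by (simp add: p extent_order_def carrier_coded)
    also have "\<dots> \<longleftrightarrow> p \<in> ord E"
      using ord_iff_clopen_ups[of x y] order_field[of x y] p by metis
    finally show "p \<in> extent_order coded_system \<longleftrightarrow> p \<in> ord E" .
  qed
  moreover have "extent_topology coded_system = topology_of E"
  proof (rule topology_eq[THEN iffD2], intro allI iffI)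
    fix U assume U: "openin (extent_topology coded_system) U"
    show "openin (topology_of E) U"
    proof (subst openin_subopen, intro ballI)
      fix x assume "x \<in> U"
      moreover have "U \<subseteq> pts E" using U by (auto simp: C.openin_extent_topology)
      ultimately obtain V W where VW: "V \<in> clopen_ups E" "W \<in> clopen_ups E" "x \<in> V" "x \<notin> W"
        and sub: "\<forall>y \<in> pts E. y \<in> V \<and> y \<notin> W \<longrightarrow> y \<in> U"
        using U by (auto simp: C.openin_extent_topology carrier_coded)
      have "clopenin (topology_of E) (V - W)" using VW by (simp add: clopen_ups_clopen)
      moreover have "x \<in> V - W" "V - W \<subseteq> U" using VW sub clopen_ups_subset by auto
      ultimately show "\<exists>T. openin (topology_of E) T \<and> x \<in> T \<and> T \<subseteq> U" unfolding clopenin_def by blast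
    qed
  next
    fix U assume U: "openin (topology_of E) U"
    define B where "B = {V - W |V W. V \<in> clopen_ups E \<and> W \<in> clopen_ups E}"
    have BI: "V - W \<in> B" if "V \<in> clopen_ups E" "W \<in> clopen_ups E" for V W
      using that unfolding B_def by blast
    have basic: "\<exists>D \<in> B. x \<in> D \<and> D \<subseteq> U" if x: "x \<in> U" for x
    proof (rule separated_nhd_in_open[OF compact U])
      show "pts E \<in> B" using BI[of "pts E" "{}"] by simp
      show "D \<inter> D' \<in> B" if D: "D \<in> B" "D' \<in> B" for D D'
      proof -
        obtain V W V' W' where "D = V - W" "D' = V' - W'" and VW: "V \<in> clopen_ups E" "W \<in> clopen_ups E"
          "V' \<in> clopen_ups E" "W' \<in> clopen_ups E" using D unfolding B_def by blast
        then have "D \<inter> D' = (V \<inter> V') - (W \<union> W')" by blast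
        then show ?thesis using BI VW by simp
      qed
      show "closedin (topology_of E) D" if "D \<in> B" for D
      proof -
        have "clopenin (topology_of E) D" using that by (auto simp: B_def clopen_ups_clopen)
        then show ?thesis by (simp add: clopenin_def)
      qed
      show "x \<in> U" by (rule x)
      show "\<exists>D \<in> B. x \<in> D \<and> y \<notin> D" if y: "y \<in> pts E - U" for y
      proof -
        have xy: "x \<in> pts E" "y \<in> pts E" "x \<noteq> y" using x y openin_subset[OF U] by auto
        \<comment> \<open>By antisymmetry, distinct points are unrelated in at least one direction.
          One case uses a clopen up-set around \<open>x\<close>, the other the complement of one
          around \<open>y\<close>.\<close>
        then consider "(x, y) \<notin> ord E" | "(y, x) \<notin> ord E" using order_antisym by blast
        then show ?thesis
        proof cases
          case 1
          then obtain V where "V \<in> clopen_ups E" "x \<in> V" "y \<notin> V" using separation xy by blast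
          then show ?thesis using BI[of V "{}"] by auto
        next
          case 2
          then obtain V where "V \<in> clopen_ups E" "y \<in> V" "x \<notin> V" using separation xy by blast
          then show ?thesis using BI[of "pts E" V] xy by (intro bexI[of _ "pts E - V"]) auto
        qed
      qed
    qed
    have "\<exists>V \<in> clopen_ups E. \<exists>W \<in> clopen_ups E. x \<in> V \<and> x \<notin> W \<and>
        (\<forall>y \<in> pts E. y \<in> V \<and> y \<notin> W \<longrightarrow> y \<in> U)" if x: "x \<in> U" for x
    proof -
      obtain D where D: "D \<in> B" "x \<in> D" "D \<subseteq> U" using basic[OF x] by blast
      then obtain V W where VW: "V \<in> clopen_ups E" "W \<in> clopen_ups E" "D = V - W" unfolding B_def by blast
      with D have "x \<in> V \<and> x \<notin> W \<and> (\<forall>y \<in> pts E. y \<in> V \<and> y \<notin> W \<longrightarrow> y \<in> U)" by blast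
      with VW show ?thesis by blast
    qed
    then show "openin (extent_topology coded_system) U"
      using openin_subset[OF U] by (simp add: C.openin_extent_topology carrier_coded)
  qed
  ultimately show ?thesis by (intro ordered_space.equality) simp_all
qed

end

text \<open>For \<open>x\<close> in an up-set \<open>U\<close> and \<open>y\<close> outside, the
  pair is never in the order, so the clopen chosen for this pair separates them. The lattice
  generated by the chosen clopens therefore contains every clopen up-set, and its members are named
  by finite sets of finite sets of pairs.\<close>

lemma clopen_ups_lepoll:
  fixes E :: "'x ordered_space"
  assumes inf: "infinite (UNIV :: 'x set)" and esakia: "esakia_space E"
  shows "clopen_ups E \<lesssim> (UNIV :: 'x set)"
proof -
  have "\<exists>U. clopenin (topology_of E) U \<and> (fst p \<in> pts E \<longrightarrow> snd p \<in> pts E \<longrightarrow> p \<notin> ord E \<longrightarrow> fst p \<in> U \<and> snd p \<notin> U)" for p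
  proof (cases "fst p \<in> pts E \<and> snd p \<in> pts E \<and> p \<notin> ord E")
    case True
    then have "\<exists>U. clopenin (topology_of E) U \<and> up_set E U \<and> fst p \<in> U \<and> snd p \<notin> U"
      using esakia unfolding esakia_space_def by (metis prod.collapse)
    then show ?thesis by blast
  next
    case False
    \<comment> \<open>A default value, so that the choice is total on pairs.\<close>
    then show ?thesis by (intro exI[of _ "{}"]) auto
  qed
  then obtain g where g: "\<And>p. clopenin (topology_of E) (g p)"
    and sep: "\<And>x y. \<lbrakk>x \<in> pts E; y \<in> pts E; (x, y) \<notin> ord E\<rbrakk> \<Longrightarrow> x \<in> g (x, y) \<and> y \<notin> g (x, y)"
    by (metis fst_conv snd_conv)
  \<comment> \<open>Intersecting with \<open>pts E\<close> makes the empty intersection the whole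
    space, so \<open>{{}}\<close> names the top of the lattice and \<open>{}\<close> its
    bottom.\<close>
  define M where "M Q = pts E \<inter> \<Inter>(g ` Q)" for Q
  define J where "J P = \<Union>(M ` P)" for P
  define B where "B = J ` Fpow (Fpow UNIV)"
  have M: "clopenin (topology_of E) (M Q)" if "finite Q" for Q
    using that
  proof (induction rule: finite_induct)
    case (insert p Q)
    have "M (insert p Q) = g p \<inter> M Q" by (auto simp: M_def)
    then show ?case using insert g by simp
  qed (simp add: M_def)
  have BI: "J P \<in> B" if "finite P" "\<And>Q. Q \<in> P \<Longrightarrow> finite Q" for P
    using that unfolding B_def by (auto simp: Fpow_def)
  have BE: "\<exists>P. U = J P \<and> finite P \<and> (\<forall>Q \<in> P. finite Q)" if "U \<in> B" for U
    using that unfolding B_def by (auto simp: Fpow_def)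
  have "U \<in> B" if U: "U \<in> clopen_ups E" for U
  proof (rule clopenin_mem_separating_lattice)
    show "compact_space (topology_of E)" using esakia by (simp add: esakia_space_def)
    show "clopenin (topology_of E) U" using U by (simp add: clopen_ups_def)
    show "{} \<in> B" using BI[of "{}"] by (simp add: J_def)
    show "pts E \<in> B" using BI[of "{{}}"] by (simp add: J_def M_def)
    fix V V' assume "V \<in> B" "V' \<in> B"
    then obtain P P' where V: "V = J P" "V' = J P'" and P: "finite P" "\<forall>Q \<in> P. finite Q"
      "finite P'" "\<forall>Q \<in> P'. finite Q" using BE by metis
    have "V \<union> V' = J (P \<union> P')" by (auto simp: V J_def)
    then show "V \<union> V' \<in> B" using BI[of "P \<union> P'"] P by auto
    define PP where "PP = (\<lambda>(Q, Q'). Q \<union> Q') ` (P \<times> P')"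
    have "V \<inter> V' = J PP" by (auto simp: V J_def M_def PP_def)
    moreover have "J PP \<in> B" using P by (intro BI) (auto simp: PP_def)
    ultimately show "V \<inter> V' \<in> B" by simp
  next
    fix V assume "V \<in> B"
    then obtain P where V: "V = J P" and P: "finite P" "\<forall>Q \<in> P. finite Q" using BE by metis
    from P show "clopenin (topology_of E) V" unfolding V
      by (induction rule: finite_induct) (simp_all add: J_def M)
  next
    fix x y assume xy: "x \<in> U" "y \<in> pts E - U"
    have "x \<in> pts E" "(x, y) \<notin> ord E" using U xy by (auto simp: clopen_ups_def up_set_def)
    then have "x \<in> J {{(x, y)}} \<and> y \<notin> J {{(x, y)}}" using sep[of x y] xy by (simp add: J_def M_def)
    then show "\<exists>V \<in> B. x \<in> V \<and> y \<notin> V" using BI[of "{{(x, y)}}"] by auto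
  qed
  then have "clopen_ups E \<lesssim> B" by (intro subset_imp_lepoll) blast
  also have "B \<lesssim> Fpow (Fpow (UNIV :: ('x \<times> 'x) set))" unfolding B_def by (rule image_lepoll)
  also have "\<dots> \<lesssim> Fpow (UNIV :: ('x \<times> 'x) set)"
  proof (rule Fpow_lepoll)
    \<comment> \<open>\<open>Fpow_lepoll\<close> is applied twice in the chain and needs an infinite
      base set each time; here singletons of diagonal pairs provide it.\<close>
    have "infinite ((\<lambda>x. {(x, x)}) ` (UNIV :: 'x set))"
      using inf by (subst finite_image_iff) (auto simp: inj_on_def)
    moreover have "(\<lambda>x. {(x, x)}) ` UNIV \<subseteq> Fpow UNIV" by (auto simp: Fpow_def)
    ultimately show "infinite (Fpow (UNIV :: ('x \<times> 'x) set))" 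
      by (rule infinite_super[rotated])
  qed
  also have "\<dots> \<lesssim> (UNIV :: ('x \<times> 'x) set)"
    by (rule Fpow_lepoll) (use inf in \<open>simp add: finite_prod\<close>)
  also have "\<dots> \<lesssim> (UNIV :: 'x set)"
    using card_of_ordLeq[THEN iffD2, OF ordIso_imp_ordLeq[OF card_of_Times_same_infinite[OF inf]]]
    by (simp add: lepoll_def)
  finally show ?thesis .
qed

subsection \<open>The equivalence\<close>

lemma compose_restrict_id:
  assumes "f \<in> A \<rightarrow>\<^sub>E B"
  shows "compose A f (restrict id A) = f" "compose A (restrict id B) f = f"
  using assms by (auto simp: compose_def fun_eq_iff PiE_iff extensional_def)

lemma compose_GI_hom:
  assumes "f \<in> GI_hom S T" "g \<in> GI_hom T U"
    and cl: "goedel_algebra (alg U)"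
  shows "(compose (points S) (fst g) (fst f), compose (carrier (alg U)) (snd f) (snd g)) \<in> GI_hom S U"
proof -
  obtain f1 f2 where f: "f = (f1, f2)" by fastforce
  obtain g1 g2 where g: "g = (g1, g2)" by fastforce
  have U: "zero (alg U) \<in> carrier (alg U)"
    "\<And>a b. \<lbrakk>a \<in> carrier (alg U); b \<in> carrier (alg U)\<rbrakk> \<Longrightarrow> meet (alg U) a b \<in> carrier (alg U)"
    "\<And>a b. \<lbrakk>a \<in> carrier (alg U); b \<in> carrier (alg U)\<rbrakk> \<Longrightarrow> join (alg U) a b \<in> carrier (alg U)"
    "\<And>a b. \<lbrakk>a \<in> carrier (alg U); b \<in> carrier (alg U)\<rbrakk> \<Longrightarrow> imp (alg U) a b \<in> carrier (alg U)"
    using cl by (simp_all add: goedel_algebra_def heyting_algebra_def bounded_distributive_lattice_def)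
  have f1: "f1 x \<in> points T" if "x \<in> points S" for x
    using assms(1) that by (auto simp: f GI_hom_def)
  have g1: "g1 x \<in> points U" if "x \<in> points T" for x
    using assms(2) that by (auto simp: g GI_hom_def)
  have f2: "f2 b \<in> carrier (alg S)" if "b \<in> carrier (alg T)" for b
    using assms(1) that by (auto simp: f GI_hom_def heyting_hom_def)
  have g2: "g2 b \<in> carrier (alg T)" if "b \<in> carrier (alg U)" for b
    using assms(2) that by (auto simp: g GI_hom_def heyting_hom_def)
  have f2_ops: "f2 (zero (alg T)) = zero (alg S)"
    "\<And>a b. \<lbrakk>a \<in> carrier (alg T); b \<in> carrier (alg T)\<rbrakk> \<Longrightarrow> f2 (meet (alg T) a b) = meet (alg S) (f2 a) (f2 b)"
    "\<And>a b. \<lbrakk>a \<in> carrier (alg T); b \<in> carrier (alg T)\<rbrakk> \<Longrightarrow> f2 (join (alg T) a b) = join (alg S) (f2 a) (f2 b)"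
    "\<And>a b. \<lbrakk>a \<in> carrier (alg T); b \<in> carrier (alg T)\<rbrakk> \<Longrightarrow> f2 (imp (alg T) a b) = imp (alg S) (f2 a) (f2 b)"
    using assms(1) by (simp_all add: f GI_hom_def heyting_hom_def)
  have g2_ops: "g2 (zero (alg U)) = zero (alg T)"
    "\<And>a b. \<lbrakk>a \<in> carrier (alg U); b \<in> carrier (alg U)\<rbrakk> \<Longrightarrow> g2 (meet (alg U) a b) = meet (alg T) (g2 a) (g2 b)"
    "\<And>a b. \<lbrakk>a \<in> carrier (alg U); b \<in> carrier (alg U)\<rbrakk> \<Longrightarrow> g2 (join (alg U) a b) = join (alg T) (g2 a) (g2 b)"
    "\<And>a b. \<lbrakk>a \<in> carrier (alg U); b \<in> carrier (alg U)\<rbrakk> \<Longrightarrow> g2 (imp (alg U) a b) = imp (alg T) (g2 a) (g2 b)"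
    using assms(2) by (simp_all add: g GI_hom_def heyting_hom_def)
  have f_sat: "sat S x (f2 b) \<longleftrightarrow> sat T (f1 x) b" if "x \<in> points S" "b \<in> carrier (alg T)" for x b
    using assms(1) that by (simp add: f GI_hom_def)
  have g_sat: "sat T x (g2 b) \<longleftrightarrow> sat U (g1 x) b" if "x \<in> points T" "b \<in> carrier (alg U)" for x b
    using assms(2) that by (simp add: g GI_hom_def)
  show ?thesis
    unfolding GI_hom_def heyting_hom_def
    by (simp add: f g PiE_iff compose_eq U f1 g1 f2 g2 f2_ops g2_ops f_sat g_sat)
qed

text \<open>By \<open>GI_hom_eqI\<close> the unit and associativity laws need checking only for the
  maps of points, once both sides are known to be arrows.\<close>

lemma category_GI_TopSys: "category (GI_TopSys :: (('x, 'a) system, _) cat)"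
proof -
  have id: "(restrict id (points S), restrict id (carrier (alg S))) \<in> GI_hom S S"
    if "GI_system S" for S :: "('x, 'a) system"
  proof -
    interpret gi_system S by unfold_locales (fact that)
    show ?thesis by (auto simp: GI_hom_def heyting_hom_def)
  qed
  have comp: "(compose (points S) (fst g) (fst f), compose (carrier (alg U)) (snd f) (snd g)) \<in> GI_hom S U"
    if "GI_system U" "f \<in> GI_hom S T" "g \<in> GI_hom T U" for S T U :: "('x, 'a) system" and f g
    by (rule compose_GI_hom[OF that(2,3) gi_system.goedel[OF gi_system.intro[OF that(1)]]])
  have fst: "fst f \<in> points S \<rightarrow>\<^sub>E points T" if "f \<in> GI_hom S T" for S T :: "('x, 'a) system" and f
    using that by (auto simp: GI_hom_def)
  show ?thesis
    unfolding category_def GI_TopSys_def cat.simps mem_Collect_eq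
  proof (intro conjI ballI; (unfold mem_Collect_eq)?)
    fix S T :: "('x, 'a) system" and f
    assume S: "GI_system S" and T: "GI_system T" and f: "f \<in> GI_hom S T"
    show "(compose (points S) (fst f) (fst (restrict id (points S), restrict id (carrier (alg S)))),
        compose (carrier (alg T)) (snd (restrict id (points S), restrict id (carrier (alg S)))) (snd f)) = f"
      by (rule GI_hom_eqI[OF S comp[OF T id[OF S] f] f]) (simp add: compose_restrict_id[OF fst[OF f]])
    show "(compose (points S) (fst (restrict id (points T), restrict id (carrier (alg T)))) (fst f),
        compose (carrier (alg T)) (snd f) (snd (restrict id (points T), restrict id (carrier (alg T))))) = f"
      by (rule GI_hom_eqI[OF S comp[OF T f id[OF T]] f]) (simp add: compose_restrict_id[OF fst[OF f]])
  next
    fix S T U V :: "('x, 'a) system" and f g h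
    assume S: "GI_system S" "GI_system T" and U: "GI_system U" and V: "GI_system V"
      and f: "f \<in> GI_hom S T" and g: "g \<in> GI_hom T U" and h: "h \<in> GI_hom U V"
    show "(compose (points S) (fst (compose (points T) (fst h) (fst g), compose (carrier (alg V)) (snd g) (snd h))) (fst f),
        compose (carrier (alg V)) (snd f) (snd (compose (points T) (fst h) (fst g), compose (carrier (alg V)) (snd g) (snd h)))) =
      (compose (points S) (fst h) (fst (compose (points S) (fst g) (fst f), compose (carrier (alg U)) (snd f) (snd g))),
        compose (carrier (alg V)) (snd (compose (points S) (fst g) (fst f), compose (carrier (alg U)) (snd f) (snd g))) (snd h))"
      by (rule GI_hom_eqI[OF S(1) comp[OF V f comp[OF V g h]] comp[OF V comp[OF U f g] h]])
        (use compose_assoc[of "fst f" "points S" "points T" "fst h" "fst g"] fst[OF f] in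
          \<open>simp add: PiE_def\<close>)
  qed (use id comp in blast)+
qed

lemma compose_esakia_hom:
  assumes f: "f \<in> esakia_hom E F" and g: "g \<in> esakia_hom F G"
  shows "compose (pts E) g f \<in> esakia_hom E G"
proof -
  have fE: "f x \<in> pts F" if "x \<in> pts E" for x
    using f that continuous_map_image_subset_topspace by (fastforce simp: esakia_hom_def)
  have "continuous_map (topology_of E) (topology_of G) (g \<circ> f)"
    using f g by (auto simp: esakia_hom_def intro: continuous_map_compose)
  then have "continuous_map (topology_of E) (topology_of G) (compose (pts E) g f)"
    by (rule continuous_map_eq) (simp add: compose_eq)
  moreover have "\<exists>z \<in> pts E. (x, z) \<in> ord E \<and> compose (pts E) g f z = y"
    if "x \<in> pts E" "y \<in> pts G" "(compose (pts E) g f x, y) \<in> ord G" for x y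
  proof -
    have f': "\<forall>x \<in> pts E. \<forall>y \<in> pts F. (f x, y) \<in> ord F \<longrightarrow> (\<exists>z \<in> pts E. (x, z) \<in> ord E \<and> f z = y)"
      and g': "\<forall>x \<in> pts F. \<forall>y \<in> pts G. (g x, y) \<in> ord G \<longrightarrow> (\<exists>z \<in> pts F. (x, z) \<in> ord F \<and> g z = y)"
      using f g by (auto simp: esakia_hom_def)
    have "(g (f x), y) \<in> ord G" using that by (simp add: compose_eq)
    with g' fE[OF that(1)] that(2) obtain w where w: "w \<in> pts F" "(f x, w) \<in> ord F" "g w = y"
      by blast
    with f' that(1) obtain z where "z \<in> pts E" "(x, z) \<in> ord E" "f z = w"
      by blast
    with w show ?thesis by (auto simp: compose_eq)
  qed
  ultimately show ?thesis
    using f g fE by (auto simp: esakia_hom_def compose_eq)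
qed

lemma category_FESA: "category (FESA :: ('x ordered_space, _) cat)"
proof -
  have id: "restrict id (pts E) \<in> esakia_hom E E" for E :: "'x ordered_space"
  proof -
    have "continuous_map (topology_of E) (topology_of E) (restrict id (pts E))"
      by (rule continuous_map_eq[OF continuous_map_id]) simp
    then show ?thesis by (auto simp: esakia_hom_def)
  qed
  have hom: "f \<in> pts E \<rightarrow>\<^sub>E pts F" if "f \<in> esakia_hom E F" for E F :: "'x ordered_space" and f
    using that by (simp add: esakia_hom_def continuous_map_def PiE_def)
  show ?thesis
    unfolding category_def FESA_def cat.simps
  proof (intro conjI ballI)
    fix E F G H :: "'x ordered_space" and f g h
    assume f: "f \<in> esakia_hom E F" and "g \<in> esakia_hom F G" and "h \<in> esakia_hom G H"
    show "compose (pts E) (compose (pts F) h g) f = compose (pts E) h (compose (pts E) g f)"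
      using compose_assoc[of f "pts E" "pts F" h g] hom[OF f] by (simp add: PiE_def)
  qed (rule id compose_esakia_hom compose_restrict_id hom | assumption)+
qed

theorem theorem9:
  assumes "infinite (UNIV :: 'x set)"
    and "(UNIV :: 'x set) \<lesssim> (UNIV :: 'a set)"
  shows "equivalent_categories
           (GI_TopSys :: (('x, 'a) system, ('x \<Rightarrow> 'x) \<times> ('a \<Rightarrow> 'a)) cat)
           (FESA :: ('x ordered_space, 'x \<Rightarrow> 'x) cat)"
proof -
  define F :: "(('x, 'a) system, ('x \<Rightarrow> 'x) \<times> ('a \<Rightarrow> 'a), 'x ordered_space, 'x \<Rightarrow> 'x) ftor"
    where "F = \<lparr>obj_map = space_of, arr_map = (\<lambda>_ _. fst)\<rparr>"
  have F_simps [simp]: "obj_map F = space_of" "arr_map F S T = fst" for S T by (simp_all add: F_def)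
  have Obj: "X \<in> Obj GI_TopSys \<longleftrightarrow> GI_system X" for X :: "('x, 'a) system" by (simp add: GI_TopSys_def)
  have Hom: "Hom GI_TopSys = (GI_hom :: ('x, 'a) system \<Rightarrow> ('x, 'a) system \<Rightarrow> _)" "Hom FESA = (esakia_hom :: 'x ordered_space \<Rightarrow> _)"
    by (simp_all add: GI_TopSys_def FESA_def)
  have pts: "pts (space_of S) = points S" if "GI_system S" for S :: "('x, 'a) system"
    using gi_system.topspace_extent[OF gi_system.intro[OF that]] by simp
  show ?thesis
  proof (rule equivalent_categories_if_fully_faithful_surj[OF category_GI_TopSys category_FESA])
    show "is_functor GI_TopSys FESA F"
      unfolding is_functor_def F_simps Obj Hom
    proof (intro conjI ballI)
      fix S assume "S \<in> Obj (GI_TopSys :: (('x, 'a) system, _) cat)"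
      then have S: "GI_system S" by (simp add: Obj)
      interpret gi_system S by unfold_locales (fact S)
      have "pts (space_of S) \<noteq> {}" using points_ne unfolding pts[OF S] .
      then show "space_of S \<in> Obj FESA"
        using esakia_space_space_of forest_space_of unfolding FESA_def cat.simps mem_Collect_eq by blast
      show "fst (Id GI_TopSys S) = Id FESA (space_of S)" by (simp add: GI_TopSys_def FESA_def)
    next
      fix S T :: "('x, 'a) system" and f :: "('x \<Rightarrow> 'x) \<times> ('a \<Rightarrow> 'a)"
      assume "S \<in> Obj GI_TopSys" "T \<in> Obj GI_TopSys" "f \<in> GI_hom S T"
      then show "fst f \<in> esakia_hom (space_of S) (space_of T)"
        using GI_hom_esakia_hom[of S T "fst f" "snd f"] by (simp add: Obj)
    next
      fix S T U :: "('x, 'a) system" and f g :: "('x \<Rightarrow> 'x) \<times> ('a \<Rightarrow> 'a)"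
      assume "S \<in> Obj GI_TopSys"
      then have "pts (space_of S) = points S" by (simp only: Obj pts)
      then show "fst (Comp GI_TopSys S T U g f) =
          Comp FESA (space_of S) (space_of T) (space_of U) (fst g) (fst f)"
        unfolding GI_TopSys_def FESA_def cat.simps by (simp only: fst_conv)
    qed
  next
    fix X Y :: "('x, 'a) system" and g
    assume "X \<in> Obj GI_TopSys" "Y \<in> Obj GI_TopSys" "g \<in> Hom FESA (obj_map F X) (obj_map F Y)"
    then show "\<exists>f \<in> Hom GI_TopSys X Y. arr_map F X Y f = g"
      using esakia_hom_lift[of X Y g] by (force simp: Obj Hom)
  next
    fix X Y :: "('x, 'a) system"
    assume "X \<in> Obj GI_TopSys"
    then have X: "GI_system X" by (simp only: Obj)
    show "inj_on (arr_map F X Y) (Hom GI_TopSys X Y)"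
      unfolding Hom F_simps by (rule inj_onI) (rule GI_hom_eqI[OF X])
  next
    fix E :: "'x ordered_space" assume "E \<in> Obj FESA"
    then have E: "esakia_space E" "forest E" "pts E \<noteq> {}" by (simp_all add: FESA_def)
    \<comment> \<open>Both cardinality hypotheses are used here: infinity of \<open>'x\<close>
      bounds the clopen up-sets by \<open>'x\<close>, and the embedding of \<open>'x\<close> carries
      them into \<open>'a\<close>.\<close>
    have "clopen_ups E \<lesssim> (UNIV :: 'a set)"
      using clopen_ups_lepoll[OF assms(1) E(1)] assms(2) by (rule lepoll_trans)
    then obtain e :: "'x set \<Rightarrow> 'a" where "inj_on e (clopen_ups E)" by (auto simp: lepoll_def)
    then interpret coded_esakia_space E e by (rule coded_esakia_space.intro[OF E])
    show "\<exists>X \<in> Obj (GI_TopSys :: (('x, 'a) system, _) cat). obj_map F X = E"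
      using coded_GI_system space_of_coded_system unfolding F_simps Bex_def Obj by blast
  qed
qed

end
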